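(* Let $S$ be a metric space with its Borel $\sigma$-algebra and let $B=(B(x,dy):x,y\in S)$ be a non-negative sub-stochastic kernel on $S$. Assume there exist a probability $\nu$ on $S$ and $m\ge1$ such that $B^m(x,dy)=b_m(x,y)\,\nu(dy)$ for $x,y\in S$, for some positive density $(b_m(x,y):x,y\in S)$. Assume also that there exist $v\in S$ and $c_1,c_2\in\mathbf{R}_+$ such that $$0<c_1=\inf_{x,y\in S}\frac{b_m(x,y)}{b_m(v,y)}\le\sup_{x,y\in S}\frac{b_m(x,y)}{b_m(v,y)}=c_2<\infty .$$ Let $\lambda_*$, $u_*$ and $\eta_*$ be as defined in the context. Then for every $x\in S$ and every measurable $C\subseteq S$ with $\eta_*(C)>0$, $$B^n(x,C)\sim\lambda_*^{n/m}\,\frac{u_*(x)\,\eta_*(C)}{\int_Su_*(w)\,\eta_*(dw)}\qquad\text{as }n\to\infty .$$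
   Context: A non-negative sub-stochastic kernel is a kernel $B$ with $B(x,\cdot)$ a non-negative measure on $S$ and $B(x,S)\le1$ for each $x\in S$ (with the usual measurability in $x$; $b_m$ is jointly measurable); $B^n$ is the $n$-fold composition. $a_n\sim b_n$ means $a_n/b_n\to1$. For measurable $C\subseteq S$ put $\psi(C)=\int_Cb_m(v,y)\nu(dy)\big/\int_Sb_m(v,y)\nu(dy)$, $\delta=c_1\int_Sb_m(v,y)\nu(dy)$, and $\tilde B(x,dy)=B^m(x,dy)-\delta\psi(dy)$, which is a non-negative kernel, with $0<\delta\le1$. Let $\Delta\notin S$ and let $X=(X_n:n\ge0)$ be the Markov chain on $S\cup\{\Delta\}$ which moves on $S$ according to $B$, jumps from $x\in S$ to $\Delta$ with probability $1-B(x,S)$, and is absorbed at $\Delta$; $T=\inf\{n\ge0:X_n=\Delta\}$. The $m$-skeleton $(X_{km}:k\ge0)$ is realized with randomization using $B^m=\delta\psi+\tilde B$: when $X_{km}\in S$, with probability $\delta$, $X_{(k+1)m}$ is drawn from $\psi$ (independently of the past); with probability $\tilde B(X_{km},dy)$, $X_{(k+1)m}\in dy$; with probability $1-B^m(X_{km},S)$, $X_{(k+1)m}=\Delta$. Let $\tau$ be the first $k\ge1$ at which $X_{km}$ is drawn from $\psi$ via the first alternative ($\tau=\infty$ if this never happens). $E_x$ is expectation given $X_0=x$, and $E_\psi=\int_S\psi(dx)E_x$. $I(\cdot)$ is the indicator, and $I(T>\tau m)$ is interpreted as $\sum_{k=1}^\infty I(\tau=k,T>km)$. Under the assumptions of the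 claim there exists $\theta\ge0$ such that $E_\psi e^{\theta\tau}I(T>\tau m)=1$, with $E_\psi\tau e^{\theta\tau}I(T>\tau m)<\infty$. For this $\theta$ set $\lambda_*=e^{-\theta}$ and $$u_*(x)=E_xe^{\theta\tau}I(T>\tau m),\qquad\eta_*(C)=E_\psi\sum_{j=0}^{\tau-1}e^{\theta j}I(X_{jm}\in C,\;T>jm)$$ for $x\in S$ and measurable $C\subseteq S$. *)

theory Defs
  imports "HOL-Probability.Probability"
begin

section \<open>Sub-stochastic kernels\<close>

primrec kernel_power ::
  "('a::topological_space \<Rightarrow> 'a measure) \<Rightarrow> nat \<Rightarrow> 'a \<Rightarrow> 'a measure" where
  "kernel_power B 0 = return borel"
| "kernel_power B (Suc n) = (\<lambda>x. B x \<bind> kernel_power B n)"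

definition psi :: "'a measure \<Rightarrow> ('a \<Rightarrow> 'a \<Rightarrow> real) \<Rightarrow> 'a \<Rightarrow> 'a measure" where
  "psi \<nu> b v = density \<nu> (\<lambda>y. ennreal (b v y / (\<integral>z. b v z \<partial>\<nu>)))"

definition delta :: "'a measure \<Rightarrow> ('a \<Rightarrow> 'a \<Rightarrow> real) \<Rightarrow> 'a \<Rightarrow> real \<Rightarrow> real" where
  "delta \<nu> b v c1 = c1 * (\<integral>y. b v y \<partial>\<nu>)"

section \<open>The killed chain and its randomized skeleton\<close>

text \<open>The state space \<open>S \<union> {\<Delta>}\<close> is rendered by the option type, with \<open>\<Delta> = None\<close>; a set is
  measurable if its trace on \<open>S\<close> is.\<close>

definition killed_space :: "'a::topological_space option measure" where
  "killed_space = sigma UNIV {A. Some -` A \<in> sets borel}"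

definition killed_kernel :: "('a \<Rightarrow> 'a measure) \<Rightarrow> 'a option \<Rightarrow> 'a option set \<Rightarrow> ennreal" where
  "killed_kernel B z A = (case z of
      None \<Rightarrow> indicator A None
    | Some x \<Rightarrow> emeasure (B x) (Some -` A) + (1 - emeasure (B x) UNIV) * indicator A None)"

text \<open>\<open>split_kernel K \<delta> \<psi> z d A\<close> is the probability that the next skeleton state lies in \<open>A\<close> and
  that the first alternative (a draw from \<open>\<psi>\<close>) was used (\<open>d = True\<close>) or not (\<open>d = False\<close>),
  given that the current skeleton state is \<open>z\<close>.  The difference of measures is
  \<open>K(x,dy) - \<delta> \<psi>(dy)\<close>.\<close>

definition split_kernel ::
  "('a \<Rightarrow> 'a measure) \<Rightarrow> real \<Rightarrow> 'a measure \<Rightarrow> 'a option \<Rightarrow> bool \<Rightarrow> 'a option set \<Rightarrow> ennreal" where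
  "split_kernel K \<delta> \<psi> z d A = (case z of
      None \<Rightarrow> (if d then 0 else indicator A None)
    | Some x \<Rightarrow>
        (if d then ennreal \<delta> * emeasure \<psi> (Some -` A)
         else emeasure (diff_measure (K x) (scale_measure (ennreal \<delta>) \<psi>)) (Some -` A)
              + (1 - emeasure (K x) UNIV) * indicator A None))"

text \<open>A realization: \<open>P x\<close> is the law under which \<open>X\<^sub>0 = x\<close>, \<open>F n\<close> is the past up to time \<open>n\<close>,
  and \<open>D k\<close> (for \<open>k \<ge> 1\<close>) is the event that \<open>X\<close> at time \<open>k m\<close> was drawn from \<open>\<psi>\<close> via the first
  alternative.\<close>

locale split_chain =
  fixes B :: "'a::topological_space \<Rightarrow> 'a measure" and m :: nat
    and \<delta> :: real and \<psi> :: "'a measure"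
    and P :: "'a \<Rightarrow> 'w measure" and F :: "nat \<Rightarrow> 'w measure"
    and X :: "nat \<Rightarrow> 'w \<Rightarrow> 'a option" and D :: "nat \<Rightarrow> 'w \<Rightarrow> bool"
  assumes prob: "prob_space (P x)"
    and subalg: "subalgebra (P x) (F n)"
    and filtr: "sets (F n) \<subseteq> sets (F (Suc n))"
    and X_adapted: "X n \<in> F n \<rightarrow>\<^sub>M killed_space"
    and D_adapted: "D k \<in> F (k * m) \<rightarrow>\<^sub>M count_space UNIV"
    and initial: "AE \<omega> in P x. X 0 \<omega> = Some x"
    and markov: "H \<in> sets (F n) \<Longrightarrow> A \<in> sets killed_space \<Longrightarrow>
      emeasure (P x) {\<omega> \<in> H. X (Suc n) \<omega> \<in> A}
        = (\<integral>\<^sup>+\<omega>\<in>H. killed_kernel B (X n \<omega>) A \<partial>P x)"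
    and skeleton: "H \<in> sets (F (k * m)) \<Longrightarrow> A \<in> sets killed_space \<Longrightarrow>
      emeasure (P x) {\<omega> \<in> H. D (Suc k) \<omega> = d \<and> X (Suc k * m) \<omega> \<in> A}
        = (\<integral>\<^sup>+\<omega>\<in>H. split_kernel (kernel_power B m) \<delta> \<psi> (X (k * m) \<omega>) d A \<partial>P x)"

definition absorption_time :: "(nat \<Rightarrow> 'w \<Rightarrow> 'a option) \<Rightarrow> 'w \<Rightarrow> enat" where
  "absorption_time X \<omega> = Inf {enat n |n. X n \<omega> = None}"

definition regeneration_time :: "(nat \<Rightarrow> 'w \<Rightarrow> bool) \<Rightarrow> 'w \<Rightarrow> enat" where
  "regeneration_time D \<omega> = Inf {enat k |k. 1 \<le> k \<and> D k \<omega>}"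

section \<open>Regenerative functionals\<close>

text \<open>\<open>regen_expectation m P X D f x\<close> is \<open>E\<^sub>x f(\<tau>) I(T > \<tau> m)\<close>, read as
  \<open>E\<^sub>x \<Sum>k\<ge>1. f(k) I(\<tau> = k, T > k m)\<close>.\<close>

definition regen_expectation ::
  "nat \<Rightarrow> ('a \<Rightarrow> 'w measure) \<Rightarrow> (nat \<Rightarrow> 'w \<Rightarrow> 'a option) \<Rightarrow> (nat \<Rightarrow> 'w \<Rightarrow> bool)
    \<Rightarrow> (nat \<Rightarrow> real) \<Rightarrow> 'a \<Rightarrow> ennreal" where
  "regen_expectation m P X D f x =
    (\<integral>\<^sup>+\<omega>. (\<Sum>i. let k = Suc i in
        ennreal (f k) * of_bool (regeneration_time D \<omega> = enat k \<and> enat (k * m) < absorption_time X \<omega>))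
      \<partial>P x)"

definition regen_parameter ::
  "nat \<Rightarrow> 'a measure \<Rightarrow> ('a \<Rightarrow> 'w measure) \<Rightarrow> (nat \<Rightarrow> 'w \<Rightarrow> 'a option) \<Rightarrow> (nat \<Rightarrow> 'w \<Rightarrow> bool)
    \<Rightarrow> real \<Rightarrow> bool" where
  "regen_parameter m \<psi> P X D \<theta> \<longleftrightarrow>
    0 \<le> \<theta> \<and>
    (\<integral>\<^sup>+x. regen_expectation m P X D (\<lambda>k. exp (\<theta> * real k)) x \<partial>\<psi>) = 1 \<and>
    (\<integral>\<^sup>+x. regen_expectation m P X D (\<lambda>k. real k * exp (\<theta> * real k)) x \<partial>\<psi>) < \<infinity>"

definition u_star ::
  "nat \<Rightarrow> ('a \<Rightarrow> 'w measure) \<Rightarrow> (nat \<Rightarrow> 'w \<Rightarrow> 'a option) \<Rightarrow> (nat \<Rightarrow> 'w \<Rightarrow> bool)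
    \<Rightarrow> real \<Rightarrow> 'a \<Rightarrow> ennreal" where
  "u_star m P X D \<theta> x = regen_expectation m P X D (\<lambda>k. exp (\<theta> * real k)) x"

definition eta_star ::
  "nat \<Rightarrow> 'a::topological_space measure \<Rightarrow> ('a \<Rightarrow> 'w measure) \<Rightarrow> (nat \<Rightarrow> 'w \<Rightarrow> 'a option)
    \<Rightarrow> (nat \<Rightarrow> 'w \<Rightarrow> bool) \<Rightarrow> real \<Rightarrow> 'a measure" where
  "eta_star m \<psi> P X D \<theta> = measure_of UNIV (sets borel) (\<lambda>C.
    \<integral>\<^sup>+x. (\<integral>\<^sup>+\<omega>. (\<Sum>j. of_bool (enat j < regeneration_time D \<omega>) * ennreal (exp (\<theta> * real j))
        * of_bool (X (j * m) \<omega> \<in> Some ` C \<and> enat (j * m) < absorption_time X \<omega>))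
      \<partial>P x) \<partial>\<psi>)"

section \<open>Existence of a realization\<close>

text \<open>The killed chain is run together with independent uniform variables \<open>U\<^sub>n\<close>, and \<open>D k\<close> is decided
  in retrospect: it holds if \<open>U\<^bsub>k m\<^esub> < c\<^sub>1 b(v, y) / b(x, y)\<close>, where \<open>x\<close> and \<open>y\<close> are the states at times
  \<open>(k - 1) m\<close> and \<open>k m\<close>.  The acceptance ratio is the density of \<open>\<delta> \<psi>\<close> with respect to
  \<open>B\<^sup>m(x, \<cdot>)\<close>.\<close>

lemma space_killed_space [simp]: "space killed_space = UNIV"
  by (simp add: killed_space_def space_measure_of_conv)

lemma sets_killed_space:
  "sets (killed_space :: 'a::topological_space option measure) = {A. Some -` A \<in> sets borel}"
proof -
  have "sigma_algebra UNIV {A. Some -` A \<in> sets (borel :: 'a measure)}"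
    unfolding sigma_algebra_iff2
    by (auto simp: vimage_Diff vimage_UN intro!: sets.compl_sets[of _ "borel :: 'a measure", simplified])
  then show ?thesis
    unfolding killed_space_def by (auto simp: sets_measure_of_conv dest: sigma_algebra.sigma_sets_eq)
qed

lemma measurable_Some [measurable]: "Some \<in> borel \<rightarrow>\<^sub>M killed_space"
  by (rule measurableI) (auto simp: sets_killed_space)

lemma measurable_killed_space:
  assumes "(\<lambda>x. f (Some x)) \<in> borel \<rightarrow>\<^sub>M N" "f None \<in> space N"
  shows "f \<in> killed_space \<rightarrow>\<^sub>M N"
proof (rule measurableI)
  fix z assume "z \<in> space (killed_space :: 'a option measure)"
  then show "f z \<in> space N"
    using assms measurable_space[OF assms(1)] by (cases z) auto
next
  fix A assume "A \<in> sets N"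
  from measurable_sets[OF assms(1) this] show "f -` A \<inter> space killed_space \<in> sets killed_space"
    by (simp add: sets_killed_space vimage_def)
qed

lemma measurable_killed_space_pair:
  assumes "(\<lambda>(x, y). f (Some x) y) \<in> borel \<Otimes>\<^sub>M M \<rightarrow>\<^sub>M N" "f None \<in> M \<rightarrow>\<^sub>M N"
  shows "(\<lambda>(z, y). f z y) \<in> killed_space \<Otimes>\<^sub>M M \<rightarrow>\<^sub>M N"
proof -
  define g where "g = (\<lambda>z. case z of None \<Rightarrow> (undefined :: 'a) | Some x \<Rightarrow> x)"
  have g[measurable]: "g \<in> killed_space \<rightarrow>\<^sub>M borel"
    by (rule measurable_killed_space) (auto simp: g_def)
  have p[measurable]: "Measurable.pred killed_space (\<lambda>z :: 'a option. z = None)"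
    by (rule measurable_killed_space) auto
  have 1[measurable]: "(\<lambda>p. f (Some (g (fst p))) (snd p)) \<in> killed_space \<Otimes>\<^sub>M M \<rightarrow>\<^sub>M N"
    using measurable_compose[OF _ assms(1), of "\<lambda>p. (g (fst p), snd p)"] by simp
  have 2[measurable]: "(\<lambda>p. f None (snd p)) \<in> (killed_space :: 'a option measure) \<Otimes>\<^sub>M M \<rightarrow>\<^sub>M N"
    by (rule measurable_compose[OF measurable_snd assms(2)])
  have "(\<lambda>p. if fst p = None then f None (snd p) else f (Some (g (fst p))) (snd p))
      \<in> killed_space \<Otimes>\<^sub>M M \<rightarrow>\<^sub>M N"
    by measurable
  also have "(\<lambda>p. if fst p = None then f None (snd p) else f (Some (g (fst p))) (snd p)) = (\<lambda>(z, y). f z y)"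
    by (auto simp: g_def split: option.split)
  finally show ?thesis .
qed

definition killed :: "('a::topological_space \<Rightarrow> 'a measure) \<Rightarrow> 'a option \<Rightarrow> 'a option measure" where
  "killed B z = measure_of UNIV (sets killed_space) (killed_kernel B z)"

lemma space_killed [simp]: "space (killed B z) = UNIV"
  by (simp add: killed_def space_measure_of_conv)

lemma sets_killed [simp, measurable_cong]: "sets (killed B z) = sets killed_space"
  using sets.sigma_sets_eq[of "killed_space :: 'a::topological_space option measure"]
  by (simp add: killed_def sets_measure_of_conv)

context
  fixes B :: "'a::topological_space \<Rightarrow> 'a measure"
  assumes B: "B \<in> borel \<rightarrow>\<^sub>M subprob_algebra borel"
begin

lemma B_sets: "sets (B x) = sets borel" "space (B x) = UNIV"
  using subprob_measurableD[OF B] by auto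

lemma B_le: "emeasure (B x) A \<le> 1"
  using B by (intro subprob_space.subprob_emeasure_le_1) (auto dest: subprob_space_kernel)

lemma emeasure_killed: "A \<in> sets killed_space \<Longrightarrow> emeasure (killed B z) A = killed_kernel B z A"
  unfolding killed_def
proof (rule emeasure_measure_of_sigma)
  show "sigma_algebra UNIV (sets (killed_space :: 'a option measure))"
    using sets.sigma_algebra_axioms[of "killed_space :: 'a option measure"] by simp
  show "positive (sets killed_space) (killed_kernel B z)"
    by (auto simp: positive_def killed_kernel_def split: option.split)
  show "countably_additive (sets killed_space) (killed_kernel B z)"
  proof (rule countably_additiveI)
    fix A :: "nat \<Rightarrow> 'a option set"
    assume A: "range A \<subseteq> sets killed_space" "disjoint_family A" "\<Union> (range A) \<in> sets killed_space"
    have ind: "(\<Sum>i. indicator (A i) None) = (indicator (\<Union> (range A)) None :: ennreal)"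
      using A(2) by (rule suminf_indicator)
    show "(\<Sum>i. killed_kernel B z (A i)) = killed_kernel B z (\<Union> (range A))"
    proof (cases z)
      case None then show ?thesis using ind by (simp add: killed_kernel_def)
    next
      case (Some x)
      have "(\<Sum>i. emeasure (B x) (Some -` A i)) = emeasure (B x) (\<Union>i. Some -` A i)"
        using A by (intro suminf_emeasure)
          (auto simp: sets_killed_space B_sets disjoint_family_on_def)
      then show ?thesis
        using Some ind by (simp add: killed_kernel_def suminf_add[symmetric] vimage_UN)
    qed
  qed
qed

lemma prob_space_killed: "prob_space (killed B z)"
proof
  have "UNIV \<in> sets (killed_space :: 'a option measure)"
    by (simp add: sets_killed_space)
  from emeasure_killed[OF this, of z] B_le show "emeasure (killed B z) (space (killed B z)) = 1"
    by (auto simp: killed_kernel_def split: option.split)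
qed

lemma measurable_killed [measurable]: "killed B \<in> killed_space \<rightarrow>\<^sub>M subprob_algebra killed_space"
proof (rule measurable_subprob_algebra)
  fix A :: "'a option set" assume A: "A \<in> sets killed_space"
  have 1: "(\<lambda>x. emeasure (B x) (Some -` A)) \<in> borel_measurable borel"
    using A by (intro measurable_emeasure_kernel[OF B]) (simp add: sets_killed_space)
  have 2: "(\<lambda>x. emeasure (B x) UNIV) \<in> borel_measurable borel"
    by (intro measurable_emeasure_kernel[OF B]) simp
  show "(\<lambda>z. emeasure (killed B z) A) \<in> borel_measurable killed_space"
    unfolding emeasure_killed[OF A]
    using 1 2 by (intro measurable_killed_space) (auto simp: killed_kernel_def)
qed (auto intro: prob_space_imp_subprob_space prob_space_killed)

lemma nn_integral_killed:
  assumes f: "f \<in> borel_measurable killed_space"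
  shows "(\<integral>\<^sup>+y. f y \<partial>killed B z) = (case z of None \<Rightarrow> f None
    | Some x \<Rightarrow> (\<integral>\<^sup>+y. f (Some y) \<partial>B x) + (1 - emeasure (B x) UNIV) * f None)"
  using f
proof (induction rule: borel_measurable_induct)
  case (cong f g)
  then have "f = g" by auto
  with cong show ?case by (simp split: option.split)
next
  case (set A)
  have "(\<integral>\<^sup>+y. indicator A (Some y) \<partial>B x) = emeasure (B x) (Some -` A)" for x
  proof -
    have "(\<integral>\<^sup>+y. indicator A (Some y) \<partial>B x) = (\<integral>\<^sup>+y. indicator (Some -` A) y \<partial>B x)"
      by (intro nn_integral_cong) (auto simp: indicator_def)
    then show ?thesis using set by (simp add: B_sets sets_killed_space)
  qed
  then show ?case using set
    by (auto simp: emeasure_killed killed_kernel_def split: option.split)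
next
  case (mult u c)
  have [measurable]: "(\<lambda>y. u (Some y)) \<in> borel_measurable (B x)" for x
    using measurable_compose[OF measurable_Some mult(2)] by (simp add: measurable_cong_sets[OF B_sets(1) refl])
  show ?case using mult
    by (auto simp: nn_integral_cmult distrib_left mult.left_commute split: option.split)
next
  case (add u w)
  have [measurable]: "(\<lambda>y. u (Some y)) \<in> borel_measurable (B x)"
       "(\<lambda>y. w (Some y)) \<in> borel_measurable (B x)" for x
    using measurable_compose[OF measurable_Some \<open>u \<in> borel_measurable killed_space\<close>]
      measurable_compose[OF measurable_Some \<open>w \<in> borel_measurable killed_space\<close>]
    by (simp_all add: measurable_cong_sets[OF B_sets(1) refl])
  show ?case using add
    by (auto simp: nn_integral_add distrib_left split: option.splits)
next
  case (seq U)
  have [measurable]: "(\<lambda>y. U i (Some y)) \<in> borel_measurable (B x)" for i x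
    using measurable_compose[OF measurable_Some seq(1)] by (simp add: measurable_cong_sets[OF B_sets(1) refl])
  have inc: "incseq (\<lambda>i. U i y)" for y
    using seq(3) by (auto simp: incseq_def le_fun_def)
  have "(\<integral>\<^sup>+y. (SUP i. U i) y \<partial>killed B z) = (SUP i. \<integral>\<^sup>+y. U i y \<partial>killed B z)"
    using nn_integral_monotone_convergence_SUP[OF seq(3), of "killed B z"] seq(1)
    by (simp add: image_comp)
  moreover have "(\<integral>\<^sup>+y. (SUP i. U i) (Some y) \<partial>B x) = (SUP i. \<integral>\<^sup>+y. U i (Some y) \<partial>B x)" for x
    using seq(3) by (subst nn_integral_monotone_convergence_SUP[symmetric]) (auto simp: image_comp incseq_def le_fun_def)
  moreover have "incseq (\<lambda>i. \<integral>\<^sup>+y. U i (Some y) \<partial>B x)" for x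
    using inc by (auto simp: incseq_def intro!: nn_integral_mono)
  moreover have "incseq (\<lambda>i. (1 - emeasure (B x) UNIV) * U i None)" for x
    using inc by (auto simp: incseq_def intro!: mult_left_mono)
  ultimately show ?case
    using seq(5) by (auto simp: image_comp SUP_mult_left_ennreal ennreal_SUP_add[symmetric] split: option.split)
qed

end

lemma kernel_power_measurable [measurable]:
  assumes B: "B \<in> borel \<rightarrow>\<^sub>M subprob_algebra borel"
  shows "kernel_power B n \<in> borel \<rightarrow>\<^sub>M subprob_algebra borel"
  by (induction n) (auto intro!: measurable_bind' B[THEN measurable_compose[rotated]] B
      return_measurable measurable_compose[OF measurable_snd])

lemma nn_integral_killed_measurable:
  assumes B: "B \<in> borel \<rightarrow>\<^sub>M subprob_algebra borel"
    and f: "(\<lambda>(x, y). f x y) \<in> borel_measurable (M \<Otimes>\<^sub>M killed_space)"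
    and g: "g \<in> M \<rightarrow>\<^sub>M killed_space"
  shows "(\<lambda>x. \<integral>\<^sup>+y. f x y \<partial>killed B (g x)) \<in> borel_measurable M"
  by (rule nn_integral_measurable_subprob_algebra2[OF f])
     (rule measurable_compose[OF g measurable_killed[OF B]])

lemma ennreal_diff_add_diff:
  fixes b c :: ennreal
  assumes "c \<le> b" "b \<le> 1"
  shows "(b - c) + (1 - b) = 1 - c"
proof -
  have b: "b < \<top>" using assms(2) by (rule le_less_trans) simp
  have c: "c < \<top>" using assms(1) b by (rule le_less_trans)
  from b c  obtain b' c' where "b = ennreal b'" "0 \<le> b'" "c = ennreal c'" "0 \<le> c'"
    by (metis ennreal_cases less_irrefl)
  with assms show ?thesis
    by (simp add: ennreal_minus flip: ennreal_1 ennreal_plus)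
qed

lemma nn_integral_killed_power:
  fixes B :: "'a::topological_space \<Rightarrow> 'a measure"
  assumes B: "B \<in> borel \<rightarrow>\<^sub>M subprob_algebra borel"
    and f: "f \<in> borel_measurable killed_space"
  shows "(\<integral>\<^sup>+z'. \<integral>\<^sup>+y. f y \<partial>killed (kernel_power B n) z' \<partial>killed B z)
    = (\<integral>\<^sup>+y. f y \<partial>killed (kernel_power B (Suc n)) z)"
proof -
  note K = kernel_power_measurable[OF B]
  have f': "(\<lambda>(x :: 'a option, y). f y) \<in> borel_measurable (killed_space \<Otimes>\<^sub>M killed_space)"
    using f by measurable
  have m: "(\<lambda>z'. \<integral>\<^sup>+y. f y \<partial>killed (kernel_power B n) z') \<in> borel_measurable killed_space"
    by (rule nn_integral_killed_measurable[OF K f']) simp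
  have fS[measurable]: "(\<lambda>y. f (Some y)) \<in> borel_measurable borel"
    by (rule measurable_compose[OF measurable_Some f])
  show ?thesis
  proof (cases z)
    case None
    show ?thesis
      unfolding None
      by (subst nn_integral_killed[OF B m]) (simp add: nn_integral_killed[OF K f] del: kernel_power.simps)
  next
    case (Some x)
    let ?b = "emeasure (B x) UNIV" and ?c = "\<lambda>w. emeasure (kernel_power B n w) UNIV"
    have sB: "sets (B x) = sets borel" by (rule B_sets[OF B])
    have [measurable]: "?c \<in> borel_measurable (B x)"
      using measurable_emeasure_kernel[OF K, of UNIV] by (simp add: measurable_cong_sets[OF sB refl])
    have [measurable]: "(\<lambda>w. \<integral>\<^sup>+y. f (Some y) \<partial>kernel_power B n w) \<in> borel_measurable (B x)"
      using nn_integral_measurable_subprob_algebra2[of "\<lambda>_ y. f (Some y)", OF _ K]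
      by (simp add: measurable_cong_sets[OF sB refl])
    have KB: "kernel_power B n \<in> B x \<rightarrow>\<^sub>M subprob_algebra borel"
      using K by (simp add: measurable_cong_sets[OF sB refl])
    have bind: "(\<integral>\<^sup>+w. \<integral>\<^sup>+y. g y \<partial>kernel_power B n w \<partial>B x) = (\<integral>\<^sup>+y. g y \<partial>kernel_power B (Suc n) x)"
      if "g \<in> borel_measurable borel" for g
      using nn_integral_bind[OF that KB] by simp
    have bc: "(\<integral>\<^sup>+w. ?c w \<partial>B x) = emeasure (kernel_power B (Suc n) x) UNIV"
      using bind[of "\<lambda>_. 1"] B_sets[OF K] by (simp del: kernel_power.simps)
    have le: "emeasure (kernel_power B (Suc n) x) UNIV \<le> ?b"
      unfolding bc[symmetric] using nn_integral_mono[of "B x" ?c "\<lambda>_. 1"] B_le[OF K] B_sets[OF B]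
      by simp
    have "(\<integral>\<^sup>+w. 1 - ?c w \<partial>B x) = (\<integral>\<^sup>+w. 1 \<partial>B x) - (\<integral>\<^sup>+w. ?c w \<partial>B x)"
      by (rule nn_integral_diff) (use B_le[OF K] B_le[OF K, of "Suc n" x UNIV] bc in \<open>auto simp: top_unique\<close>)
    also have "\<dots> = ?b - emeasure (kernel_power B (Suc n) x) UNIV"
      using bc B_sets[OF B] by simp
    finally have d: "(\<integral>\<^sup>+w. 1 - ?c w \<partial>B x) = ?b - emeasure (kernel_power B (Suc n) x) UNIV" .
    have e: "(\<integral>\<^sup>+w. 1 - ?c w \<partial>B x) + (1 - ?b) = 1 - emeasure (kernel_power B (Suc n) x) UNIV"
      unfolding d by (rule ennreal_diff_add_diff[OF le B_le[OF B]])
    have "(\<integral>\<^sup>+z'. \<integral>\<^sup>+y. f y \<partial>killed (kernel_power B n) z' \<partial>killed B z)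
      = (\<integral>\<^sup>+w. (\<integral>\<^sup>+y. f (Some y) \<partial>kernel_power B n w) + (1 - ?c w) * f None \<partial>B x) + (1 - ?b) * f None"
      unfolding Some
      by (subst nn_integral_killed[OF B m]) (simp add: nn_integral_killed[OF K f] del: kernel_power.simps)
    also have "\<dots> = (\<integral>\<^sup>+y. f (Some y) \<partial>kernel_power B (Suc n) x)
        + ((\<integral>\<^sup>+w. 1 - ?c w \<partial>B x) + (1 - ?b)) * f None"
      by (subst nn_integral_add)
         (auto simp: nn_integral_multc bind[OF fS] distrib_right add.assoc simp del: kernel_power.simps)
    also have "\<dots> = (\<integral>\<^sup>+y. f y \<partial>killed (kernel_power B (Suc n)) z)"
      unfolding e by (simp only: Some nn_integral_killed[OF K f] option.case)
    finally show ?thesis .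
  qed
qed

abbreviation ext_space :: "('a::topological_space option \<times> real) measure" where
  "ext_space \<equiv> killed_space \<Otimes>\<^sub>M borel"

abbreviation unit_uniform :: "real measure" where
  "unit_uniform \<equiv> uniform_measure lborel {0..1}"

lemma prob_space_unit_uniform: "prob_space unit_uniform"
  by (rule prob_space_uniform_measure) auto

lemma space_ext_space: "space ext_space = UNIV"
  by (simp add: space_pair_measure)

definition chain_step :: "('a::topological_space \<Rightarrow> 'a measure) \<Rightarrow> 'a \<Rightarrow> nat \<Rightarrow> (nat \<Rightarrow> 'a option \<times> real) \<Rightarrow>
   ('a option \<times> real) measure" where
  "chain_step B x n \<omega> = (case n of 0 \<Rightarrow> return killed_space (Some x) | Suc i \<Rightarrow> killed B (fst (\<omega> i))) \<Otimes>\<^sub>M unit_uniform"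

locale chain_construction =
  fixes B :: "'a::topological_space \<Rightarrow> 'a measure"
  assumes B: "B \<in> borel \<rightarrow>\<^sub>M subprob_algebra borel"
begin

lemma UM_sub: "unit_uniform \<in> space (subprob_algebra borel)"
  using prob_space_unit_uniform by (simp add: space_subprob_algebra prob_space_imp_subprob_space)

lemma IT: "Ionescu_Tulcea (chain_step B x) (\<lambda>_. ext_space)"
proof (rule Ionescu_Tulcea.intro)
  fix i
  show "chain_step B x i \<in> PiM {0..<i} (\<lambda>_. ext_space) \<rightarrow>\<^sub>M subprob_algebra ext_space"
  proof (cases i)
    case 0
    have "return killed_space (Some x) \<in> space (subprob_algebra killed_space)"
      by (simp add: space_subprob_algebra prob_space_imp_subprob_space prob_space_return)
    then show ?thesis
      unfolding chain_step_def 0 nat.case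
      by (intro measurable_pair_measure measurable_const UM_sub)
  next
    case (Suc j)
    have "(\<lambda>\<omega>. killed B (fst (\<omega> j))) \<in> PiM {0..<i} (\<lambda>_. ext_space) \<rightarrow>\<^sub>M subprob_algebra killed_space"
      by (rule measurable_compose[OF _ measurable_killed[OF B]]) (simp add: Suc)
    then show ?thesis
      unfolding chain_step_def Suc nat.case
      by (intro measurable_pair_measure measurable_const UM_sub)
  qed
next
  fix i and \<omega> :: "nat \<Rightarrow> 'a option \<times> real"
  assume "\<omega> \<in> space (PiM {0..<i} (\<lambda>_. ext_space))"
  have pair: "prob_space (M \<Otimes>\<^sub>M unit_uniform)" if "prob_space M" for M :: "'a option measure"
  proof -
    interpret M: prob_space M by fact
    interpret U: prob_space unit_uniform by (rule prob_space_unit_uniform)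
    interpret pp: pair_prob_space M unit_uniform ..
    show ?thesis by (rule pp.P.prob_space_axioms)
  qed
  show "prob_space (chain_step B x i \<omega>)"
    unfolding chain_step_def
    by (auto split: nat.split intro!: pair prob_space_return prob_space_killed[OF B])
qed

definition law :: "'a \<Rightarrow> (nat \<Rightarrow> 'a option \<times> real) measure" where
  "law x = projective_family.lim UNIV (Ionescu_Tulcea.CI (chain_step B x) (\<lambda>_. ext_space)) (\<lambda>_. ext_space)"

lemma sets_law: "sets (law x) = sets (PiM UNIV (\<lambda>_. ext_space))"
proof -
  interpret I: Ionescu_Tulcea "chain_step B x" "\<lambda>_. ext_space" by (rule IT)
  show ?thesis unfolding law_def by (rule I.PF.sets_lim)
qed

lemma space_law: "space (law x) = UNIV"
  by (simp add: sets_eq_imp_space_eq[OF sets_law] space_PiM space_ext_space)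

abbreviation rs :: "nat \<Rightarrow> (nat \<Rightarrow> 'a option \<times> real) \<Rightarrow> nat \<Rightarrow> 'a option \<times> real" where
  "rs n \<omega> \<equiv> restrict \<omega> {0..<n}"

abbreviation Pn :: "nat \<Rightarrow> (nat \<Rightarrow> 'a option \<times> real) measure" where
  "Pn n \<equiv> PiM {0..<n} (\<lambda>_. ext_space)"

lemma rs_law[measurable]: "rs n \<in> law x \<rightarrow>\<^sub>M Pn n"
  unfolding measurable_cong_sets[OF sets_law refl] by (rule measurable_restrict_subset) simp

lemma comp_law[measurable]: "(\<lambda>\<omega>. \<omega> n) \<in> law x \<rightarrow>\<^sub>M ext_space"
  unfolding measurable_cong_sets[OF sets_law refl] by simp

lemma law_C:
  assumes f: "f \<in> borel_measurable (Pn n)"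
  shows "(\<integral>\<^sup>+\<omega>. f (rs n \<omega>) \<partial>law x) = (\<integral>\<^sup>+\<omega>. f \<omega> \<partial>Ionescu_Tulcea.C (chain_step B x) (\<lambda>_. ext_space) 0 n (\<lambda>_. undefined))"
proof -
  interpret I: Ionescu_Tulcea "chain_step B x" "\<lambda>_. ext_space" by (rule IT)
  have up: "I.up_to {0..<n} = n"
    unfolding I.up_to_def by (rule Least_equality) (auto intro: leI)
  have s: "sets (I.C 0 n (\<lambda>_. undefined)) = sets (Pn n)"
    using I.sets_C[of "\<lambda>_. undefined" 0 n] by (simp add: space_PiM)
  have "(\<integral>\<^sup>+\<omega>. f (rs n \<omega>) \<partial>law x) = (\<integral>\<^sup>+\<omega>. f \<omega> \<partial>distr (law x) (Pn n) (rs n))"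
    using f by (subst nn_integral_distr) auto
  also have "distr (law x) (Pn n) (rs n) = I.CI {0..<n}"
    unfolding law_def by (rule I.distr_lim) simp
  also have "(\<integral>\<^sup>+\<omega>. f \<omega> \<partial>I.CI {0..<n}) = (\<integral>\<^sup>+\<omega>. f (rs n \<omega>) \<partial>I.C 0 n (\<lambda>_. undefined))"
    unfolding I.CI_def up
    by (rule nn_integral_distr) (use f in \<open>auto simp: measurable_cong_sets[OF s refl] intro: measurable_restrict_subset\<close>)
  also have "\<dots> = (\<integral>\<^sup>+\<omega>. f \<omega> \<partial>I.C 0 n (\<lambda>_. undefined))"
    by (rule nn_integral_cong)
       (auto simp: sets_eq_imp_space_eq[OF s] space_PiM intro!: arg_cong[where f=f] PiE_restrict)
  finally show ?thesis .
qed

lemma prob_space_law: "prob_space (law x)"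
proof
  interpret I: Ionescu_Tulcea "chain_step B x" "\<lambda>_. ext_space" by (rule IT)
  interpret C: prob_space "I.C 0 0 (\<lambda>_. undefined)"
    by (rule I.prob_space_C) (simp add: space_PiM)
  show "emeasure (law x) (space (law x)) = 1"
    using law_C[of "\<lambda>_. 1" 0 x] C.emeasure_space_1 by simp
qed

lemma C_Suc:
  assumes f: "f \<in> borel_measurable (Pn (Suc n))"
  shows "(\<integral>\<^sup>+\<omega>. f (rs (Suc n) \<omega>) \<partial>law x) = (\<integral>\<^sup>+\<omega>. (\<integral>\<^sup>+s. f ((rs n \<omega>)(n := s)) \<partial>chain_step B x n (rs n \<omega>)) \<partial>law x)"
proof -
  interpret I: Ionescu_Tulcea "chain_step B x" "\<lambda>_. ext_space" by (rule IT)
  have s: "sets (I.C 0 n (\<lambda>_. undefined)) = sets (Pn n)"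
    using I.sets_C[of "\<lambda>_. undefined" 0 n] by (simp add: space_PiM)
  have e: "I.eP n \<in> I.C 0 n (\<lambda>_. undefined) \<rightarrow>\<^sub>M subprob_algebra (Pn (Suc n))"
    using I.measurable_eP[of n] by (simp add: measurable_cong_sets[OF s refl])
  have m: "(\<lambda>\<omega>. \<integral>\<^sup>+s. f s \<partial>I.eP n \<omega>) \<in> borel_measurable (Pn n)"
    by (rule nn_integral_measurable_subprob_algebra2[OF _ I.measurable_eP]) (use f in measurable)
  have "(\<integral>\<^sup>+\<omega>. f (rs (Suc n) \<omega>) \<partial>law x) = (\<integral>\<^sup>+\<omega>. f \<omega> \<partial>I.C 0 (Suc n) (\<lambda>_. undefined))"
    by (rule law_C[OF f])
  also have "\<dots> = (\<integral>\<^sup>+\<omega>. \<integral>\<^sup>+s. f s \<partial>I.eP n \<omega> \<partial>I.C 0 n (\<lambda>_. undefined))"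
    using nn_integral_bind[OF f e] by simp
  also have "\<dots> = (\<integral>\<^sup>+\<omega>. \<integral>\<^sup>+s. f s \<partial>I.eP n (rs n \<omega>) \<partial>law x)"
    by (rule law_C[OF m, symmetric])
  also have "\<dots> = (\<integral>\<^sup>+\<omega>. (\<integral>\<^sup>+s. f ((rs n \<omega>)(n := s)) \<partial>chain_step B x n (rs n \<omega>)) \<partial>law x)"
    by (intro nn_integral_cong I.nn_integral_eP f) (auto simp: space_PiM space_ext_space)
  finally show ?thesis .
qed

lemma nn_integral_pair_UM:
  assumes "g \<in> borel_measurable ext_space" "sets M = sets killed_space"
  shows "(\<integral>\<^sup>+s. g s \<partial>(M \<Otimes>\<^sub>M unit_uniform)) = (\<integral>\<^sup>+y. \<integral>\<^sup>+u. g (y, u) \<partial>unit_uniform \<partial>M)"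
proof -
  interpret U: prob_space unit_uniform by (rule prob_space_unit_uniform)
  have "sets (M \<Otimes>\<^sub>M unit_uniform) = sets ext_space" using assms by (intro sets_pair_measure_cong) auto
  then show ?thesis
    using assms(1) by (intro U.nn_integral_fst[symmetric]) (simp cong: measurable_cong_sets)
qed

lemma one_step:
  assumes f: "(\<lambda>(h, s). f h s) \<in> borel_measurable (Pn (Suc n) \<Otimes>\<^sub>M ext_space)"
  shows "(\<integral>\<^sup>+\<omega>. f (rs (Suc n) \<omega>) (\<omega> (Suc n)) \<partial>law x)
    = (\<integral>\<^sup>+\<omega>. \<integral>\<^sup>+y. \<integral>\<^sup>+u. f (rs (Suc n) \<omega>) (y, u) \<partial>unit_uniform \<partial>killed B (fst (\<omega> n)) \<partial>law x)"
proof -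
  let ?f = "\<lambda>\<omega>. f (rs (Suc n) \<omega>) (\<omega> (Suc n))"
  have r: "rs (Suc n) \<in> Pn (Suc (Suc n)) \<rightarrow>\<^sub>M Pn (Suc n)"
    by (rule measurable_restrict_subset) auto
  have mf: "?f \<in> borel_measurable (Pn (Suc (Suc n)))"
    using measurable_compose[OF measurable_Pair[OF r measurable_component_singleton[of "Suc n"]] f] by simp
  have "(\<integral>\<^sup>+\<omega>. f (rs (Suc n) \<omega>) (\<omega> (Suc n)) \<partial>law x) = (\<integral>\<^sup>+\<omega>. ?f (rs (Suc (Suc n)) \<omega>) \<partial>law x)"
    by (intro nn_integral_cong arg_cong2[where f=f]) auto
  also have "\<dots> = (\<integral>\<^sup>+\<omega>. (\<integral>\<^sup>+s. f (rs (Suc n) \<omega>) s \<partial>chain_step B x (Suc n) (rs (Suc n) \<omega>)) \<partial>law x)"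
    unfolding C_Suc[OF mf] by (intro nn_integral_cong arg_cong2[where f=f]) auto
  also have "\<dots> = (\<integral>\<^sup>+\<omega>. \<integral>\<^sup>+y. \<integral>\<^sup>+u. f (rs (Suc n) \<omega>) (y, u) \<partial>unit_uniform \<partial>killed B (fst (\<omega> n)) \<partial>law x)"
  proof (intro nn_integral_cong)
    fix \<omega>
    have "rs (Suc n) \<omega> \<in> space (Pn (Suc n))" by (auto simp: space_PiM space_ext_space)
    from measurable_compose[OF measurable_Pair1'[OF this] f]
    have "f (rs (Suc n) \<omega>) \<in> borel_measurable ext_space" by simp
    from nn_integral_pair_UM[OF this, of "killed B (fst (\<omega> n))"]
    show "(\<integral>\<^sup>+s. f (rs (Suc n) \<omega>) s \<partial>chain_step B x (Suc n) (rs (Suc n) \<omega>))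
      = (\<integral>\<^sup>+y. \<integral>\<^sup>+u. f (rs (Suc n) \<omega>) (y, u) \<partial>unit_uniform \<partial>killed B (fst (\<omega> n)))"
      by (simp add: chain_step_def)
  qed
  finally show ?thesis .
qed

lemma UM_measurable:
  assumes f: "(\<lambda>(h, s). f h s) \<in> borel_measurable (M \<Otimes>\<^sub>M ext_space)"
  shows "(\<lambda>(h, y). \<integral>\<^sup>+u. f h (y, u) \<partial>unit_uniform) \<in> borel_measurable (M \<Otimes>\<^sub>M killed_space)"
proof -
  interpret U: prob_space unit_uniform by (rule prob_space_unit_uniform)
  have "(\<lambda>p. (fst (fst p), (snd (fst p), snd p))) \<in> (M \<Otimes>\<^sub>M killed_space) \<Otimes>\<^sub>M borel \<rightarrow>\<^sub>M M \<Otimes>\<^sub>M ext_space"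
    by measurable
  from measurable_compose[OF this f]
  have "(\<lambda>(p, u). f (fst p) (snd p, u)) \<in> borel_measurable ((M \<Otimes>\<^sub>M killed_space) \<Otimes>\<^sub>M unit_uniform)"
    by (simp add: split_beta' cong: measurable_cong_sets sets_pair_measure_cong)
  from U.borel_measurable_nn_integral[OF this] show ?thesis by (simp add: split_beta')
qed

lemma many_steps:
  assumes f: "(\<lambda>(h, s). f h s) \<in> borel_measurable (Pn (Suc n) \<Otimes>\<^sub>M ext_space)"
  shows "(\<integral>\<^sup>+\<omega>. f (rs (Suc n) \<omega>) (\<omega> (n + Suc j)) \<partial>law x)
    = (\<integral>\<^sup>+\<omega>. \<integral>\<^sup>+y. \<integral>\<^sup>+u. f (rs (Suc n) \<omega>) (y, u) \<partial>unit_uniform \<partial>killed (kernel_power B (Suc j)) (fst (\<omega> n)) \<partial>law x)"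
  using f
proof (induction j arbitrary: n f)
  case 0
  have "B x \<bind> return borel = B x" for x
    by (rule bind_return'') (rule B_sets[OF B])
  with one_step[OF 0, of x] show ?case by simp
next
  case (Suc j)
  note K = kernel_power_measurable[OF B]
  let ?\<phi> = "\<lambda>h y. \<integral>\<^sup>+u. f h (y, u) \<partial>unit_uniform"
  let ?g = "\<lambda>h s. \<integral>\<^sup>+y. ?\<phi> h y \<partial>killed (kernel_power B (Suc j)) (fst s)"
  have r: "rs (Suc n) \<in> Pn (Suc (Suc n)) \<rightarrow>\<^sub>M Pn (Suc n)"
    by (rule measurable_restrict_subset) auto
  have f': "(\<lambda>(h, s). f (rs (Suc n) h) s) \<in> borel_measurable (Pn (Suc (Suc n)) \<Otimes>\<^sub>M ext_space)"
    using measurable_compose[OF measurable_Pair[OF measurable_compose[OF measurable_fst r] measurable_snd] Suc.prems]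
    by (simp add: split_beta')
  note \<phi> = UM_measurable[OF Suc.prems]
  have \<phi>': "(\<lambda>(p, y). ?\<phi> (fst p) y) \<in> borel_measurable ((Pn (Suc n) \<Otimes>\<^sub>M ext_space) \<Otimes>\<^sub>M killed_space)"
    using measurable_compose[OF measurable_Pair[OF measurable_compose[OF measurable_fst measurable_fst] measurable_snd] \<phi>]
    by (simp add: split_beta')
  have g: "(\<lambda>(h, s). ?g h s) \<in> borel_measurable (Pn (Suc n) \<Otimes>\<^sub>M ext_space)"
    using nn_integral_killed_measurable[OF K \<phi>', of "\<lambda>p. fst (snd p)"]
    by (simp add: split_beta' del: kernel_power.simps)
  have rr: "rs (Suc n) (rs (Suc (Suc n)) \<omega>) = rs (Suc n) \<omega>" for \<omega> by auto
  interpret U: prob_space unit_uniform by (rule prob_space_unit_uniform)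
  have "(\<integral>\<^sup>+\<omega>. f (rs (Suc n) \<omega>) (\<omega> (n + Suc (Suc j))) \<partial>law x)
     = (\<integral>\<^sup>+\<omega>. ?g (rs (Suc n) \<omega>) (\<omega> (Suc n)) \<partial>law x)"
    using Suc.IH[OF f'] by (simp only: rr add_Suc add_Suc_right)
  also have "\<dots> = (\<integral>\<^sup>+\<omega>. \<integral>\<^sup>+z. \<integral>\<^sup>+y. ?\<phi> (rs (Suc n) \<omega>) y \<partial>killed (kernel_power B (Suc j)) z \<partial>killed B (fst (\<omega> n)) \<partial>law x)"
    unfolding one_step[OF g] by (simp add: U.emeasure_space_1 del: kernel_power.simps)
  also have "\<dots> = (\<integral>\<^sup>+\<omega>. \<integral>\<^sup>+y. ?\<phi> (rs (Suc n) \<omega>) y \<partial>killed (kernel_power B (Suc (Suc j))) (fst (\<omega> n)) \<partial>law x)"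
  proof (intro nn_integral_cong nn_integral_killed_power[OF B])
    fix \<omega>
    have "rs (Suc n) \<omega> \<in> space (Pn (Suc n))" by (auto simp: space_PiM space_ext_space)
    from measurable_compose[OF measurable_Pair1'[OF this] \<phi>]
    show "?\<phi> (rs (Suc n) \<omega>) \<in> borel_measurable killed_space" by simp
  qed
  finally show ?case .
qed

definition past :: "nat \<Rightarrow> (nat \<Rightarrow> 'a option \<times> real) measure" where
  "past n = vimage_algebra UNIV (rs (Suc n)) (Pn (Suc n))"

lemma space_past: "space (past n) = UNIV" by (simp add: past_def)

lemma rs_past: "i \<le> n \<Longrightarrow> rs (Suc i) \<in> past n \<rightarrow>\<^sub>M Pn (Suc i)"
proof -
  assume "i \<le> n"
  have 1: "rs (Suc n) \<in> past n \<rightarrow>\<^sub>M Pn (Suc n)"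
    unfolding past_def by (rule measurable_vimage_algebra1) (auto simp: space_PiM space_ext_space)
  have 2: "rs (Suc i) \<in> Pn (Suc n) \<rightarrow>\<^sub>M Pn (Suc i)"
    by (rule measurable_restrict_subset) (use \<open>i \<le> n\<close> in auto)
  have "(\<lambda>\<omega>. rs (Suc i) (rs (Suc n) \<omega>)) = rs (Suc i)"
    using \<open>i \<le> n\<close> by (auto simp: fun_eq_iff)
  with measurable_compose[OF 1 2] show ?thesis by simp
qed

lemma comp_past: "i \<le> n \<Longrightarrow> (\<lambda>\<omega>. \<omega> i) \<in> past n \<rightarrow>\<^sub>M ext_space"
  using measurable_compose[OF rs_past[of i n] measurable_component_singleton[of i]] by simp

lemma pastE:
  assumes "H \<in> sets (past n)"
  obtains H' where "H' \<in> sets (Pn (Suc n))" "H = rs (Suc n) -` H'"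
  using assms unfolding past_def by (auto simp: sets_vimage_algebra2 space_PiM space_ext_space)

lemma past_law: "subalgebra (law x) (past n)"
  unfolding subalgebra_def space_law space_past
  by (auto elim!: pastE intro!: measurable_sets[OF rs_law, of _ "Suc n" x, unfolded space_law, simplified])

lemma past_mono: "sets (past n) \<subseteq> sets (past (Suc n))"
  by (auto elim!: pastE intro!: measurable_sets[OF rs_past[of n "Suc n"], unfolded space_past, simplified])

end

lemma UM_less:
  assumes "0 \<le> r" "r \<le> 1"
  shows "(\<integral>\<^sup>+u. of_bool ((u < r) = d) \<partial>unit_uniform) = ennreal (if d then r else 1 - r)"
proof -
  let ?S = "{u. (u < r) = d}"
  have S: "?S \<in> sets borel" by (cases d) auto
  have "(\<integral>\<^sup>+u. of_bool ((u < r) = d) \<partial>unit_uniform) = (\<integral>\<^sup>+u. indicator ?S u \<partial>unit_uniform)"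
    by (intro nn_integral_cong) (simp split: split_indicator)
  also have "\<dots> = emeasure unit_uniform ?S"
    using S by (intro nn_integral_indicator) simp
  also have "\<dots> = emeasure lborel ({0..1} \<inter> ?S) / emeasure lborel {0..1 :: real}"
    using S by (intro emeasure_uniform_measure) auto
  also have "\<dots> = emeasure lborel ({0..1} \<inter> ?S)"
    by (simp add: divide_ennreal_def)
  also have "{0..1} \<inter> {u. (u < r) = d} = (if d then {0..<r} else {r..1})"
    using assms by auto
  finally show ?thesis using assms by auto
qed

lemma split_chain_exists:
  fixes B :: "'a::metric_space \<Rightarrow> 'a measure"
  assumes kernel: "B \<in> borel \<rightarrow>\<^sub>M subprob_algebra borel"
    and nu: "prob_space \<nu>" "sets \<nu> = sets borel"
    and m: "1 \<le> m"
    and b_meas: "(\<lambda>(x, y). b x y) \<in> borel_measurable (borel \<Otimes>\<^sub>M borel)"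
    and b_pos: "\<And>x y. 0 < b x y"
    and b_density: "\<And>x. kernel_power B m x = density \<nu> (\<lambda>y. ennreal (b x y))"
    and c1: "0 < c1" "ereal c1 = (INF x. INF y. ereal (b x y / b v y))"
  shows "\<exists>(P :: 'a \<Rightarrow> (nat \<Rightarrow> 'a option \<times> real) measure) F X D.
    split_chain B m (delta \<nu> b v c1) (psi \<nu> b v) P F X D"
proof -
  interpret chain_construction B by standard (rule kernel)
  interpret nu: prob_space \<nu> by (rule nu)
  note K = kernel_power_measurable[OF kernel]
  define r :: "'a option \<Rightarrow> 'a option \<Rightarrow> real" where
    "r z w = (case z of None \<Rightarrow> 0 | Some x \<Rightarrow> case w of None \<Rightarrow> 0 | Some y \<Rightarrow> c1 * b v y / b x y)" for z w
  have c1_le: "c1 * b v y \<le> b x y" for x y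
  proof -
    have "ereal c1 \<le> ereal (b x y / b v y)"
      unfolding c1(2) by (intro INF_lower2[of x] INF_lower) auto
    then show ?thesis using b_pos[of v y] by (simp add: field_simps)
  qed
  have r01: "0 \<le> r z w" "r z w \<le> 1" for z w
    using c1_le c1(1) b_pos by (auto simp: r_def less_imp_le split: option.split)
  have b1[measurable]: "(\<lambda>y. b x y) \<in> borel_measurable borel" for x
    using measurable_compose[OF measurable_Pair1'[of x borel borel] b_meas] by simp
  have b1n[measurable]: "(\<lambda>y. b x y) \<in> borel_measurable \<nu>" for x
    by (simp add: measurable_cong_sets[OF nu(2) refl])
  have b2[measurable]: "(\<lambda>p. b (snd p) (fst p)) \<in> borel_measurable (borel \<Otimes>\<^sub>M borel)"
    using measurable_compose[OF measurable_pair_swap' b_meas] by (simp add: split_beta')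
  have r1: "(\<lambda>(y, x). r (Some x) (Some y)) \<in> borel_measurable (borel \<Otimes>\<^sub>M borel)"
    unfolding r_def by (simp add: split_beta')
  have "(\<lambda>(w, x). r (Some x) w) \<in> borel_measurable (killed_space \<Otimes>\<^sub>M borel)"
    by (rule measurable_killed_space_pair[OF r1]) (simp add: r_def)
  from measurable_compose[OF measurable_pair_swap' this]
  have "(\<lambda>(x, w). r (Some x) w) \<in> borel_measurable (borel \<Otimes>\<^sub>M killed_space)"
    by (simp add: split_beta')
  then have r2: "(\<lambda>(z, w). r z w) \<in> borel_measurable (killed_space \<Otimes>\<^sub>M killed_space)"
    by (rule measurable_killed_space_pair) (simp add: r_def)
  have rM: "(\<lambda>x. r (f x) (g x)) \<in> borel_measurable M"
    if "f \<in> M \<rightarrow>\<^sub>M killed_space" "g \<in> M \<rightarrow>\<^sub>M killed_space" for f g and M :: "'b measure"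
    using measurable_compose[OF measurable_Pair[OF that] r2] by simp
  define X where "X n \<omega> = fst (\<omega> n)" for n and \<omega> :: "nat \<Rightarrow> 'a option \<times> real"
  define D where "D k \<omega> \<longleftrightarrow> snd (\<omega> (k * m)) < r (X ((k - 1) * m) \<omega>) (X (k * m) \<omega>)"
    for k and \<omega> :: "nat \<Rightarrow> 'a option \<times> real"
  let ?\<delta> = "delta \<nu> b v c1" and ?\<psi> = "psi \<nu> b v"
  have Iv: "(\<integral>\<^sup>+y. ennreal (b v y) \<partial>\<nu>) \<le> 1"
    using B_le[OF K, of m v UNIV] b_density[of v] sets_eq_imp_space_eq[OF nu(2)]
    by (simp add: emeasure_density nu(2))
  have int: "integrable \<nu> (b v)"
    using Iv b_pos by (intro integrableI_nonneg) (auto simp: less_imp_le top_unique intro: le_less_trans)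
  have Ipos: "0 < (\<integral>y. b v y \<partial>\<nu>)"
    using int b_pos nu.emeasure_space_1
    nu.integral_less_AE_space[of "\<lambda>_. 0" "b v"] by simp
  have \<delta>\<psi>: "ennreal ?\<delta> * emeasure ?\<psi> A = (\<integral>\<^sup>+y. ennreal (c1 * b v y) * indicator A y \<partial>\<nu>)"
    if "A \<in> sets borel" for A
  proof -
    have "ennreal ?\<delta> * emeasure ?\<psi> A
      = (\<integral>\<^sup>+y. ennreal ?\<delta> * (ennreal (b v y / (\<integral>z. b v z \<partial>\<nu>)) * indicator A y) \<partial>\<nu>)"
      using that nu(2) unfolding psi_def by (simp add: emeasure_density nn_integral_cmult)
    also have "\<dots> = (\<integral>\<^sup>+y. ennreal (c1 * b v y) * indicator A y \<partial>\<nu>)"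
      using Ipos c1(1) b_pos
      by (intro nn_integral_cong)
         (auto simp: delta_def mult.assoc[symmetric] ennreal_mult[symmetric] less_imp_le split: split_indicator)
    finally show ?thesis .
  qed
  have diff: "emeasure (diff_measure (kernel_power B m x) (scale_measure (ennreal ?\<delta>) ?\<psi>)) A
      = (\<integral>\<^sup>+y. ennreal (b x y - c1 * b v y) * indicator A y \<partial>\<nu>)" if "A \<in> sets borel" for x A
  proof -
    have e1: "emeasure (kernel_power B m x) A = (\<integral>\<^sup>+y. ennreal (b x y) * indicator A y \<partial>\<nu>)"
      if "A \<in> sets borel" for A
      using that nu(2) by (simp add: b_density emeasure_density)
    have le: "(\<integral>\<^sup>+y. ennreal (c1 * b v y) * indicator A y \<partial>\<nu>) \<le> (\<integral>\<^sup>+y. ennreal (b x y) * indicator A y \<partial>\<nu>)" for A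
      by (intro nn_integral_mono mult_right_mono ennreal_leI c1_le) auto
    have fin: "(\<integral>\<^sup>+y. ennreal (c1 * b v y) * indicator A y \<partial>\<nu>) \<noteq> \<infinity>" if "A \<in> sets borel" for A
      using le[of A] B_le[OF K, of m x A] e1[OF that] by (auto simp: top_unique)
    have s: "sets ?\<psi> = sets borel" using nu(2) by (simp add: psi_def)
    have "emeasure (diff_measure (kernel_power B m x) (scale_measure (ennreal ?\<delta>) ?\<psi>)) A
      = emeasure (kernel_power B m x) A - emeasure (scale_measure (ennreal ?\<delta>) ?\<psi>) A"
    proof (rule emeasure_diff_measure)
      show "sets (kernel_power B m x) = sets (scale_measure (ennreal ?\<delta>) ?\<psi>)"
        using s B_sets[OF K] by simp
      show "finite_measure (kernel_power B m x)" "finite_measure (scale_measure (ennreal ?\<delta>) ?\<psi>)"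
        using B_le[OF K, of m x UNIV] B_sets[OF K] sets_eq_imp_space_eq[OF s] sets_eq_imp_space_eq[OF sets_scale_measure, of "ennreal ?\<delta>" ?\<psi>] \<delta>\<psi>[of UNIV] fin[of UNIV]
        by (auto intro!: finite_measureI simp: top_unique)
      show "emeasure (scale_measure (ennreal ?\<delta>) ?\<psi>) A \<le> emeasure (kernel_power B m x) A"
        if "A \<in> sets (kernel_power B m x)" for A
        using that B_sets[OF K] le \<delta>\<psi> e1 by simp
      show "A \<in> sets (kernel_power B m x)" using that B_sets[OF K] by simp
    qed
    also have "\<dots> = (\<integral>\<^sup>+y. ennreal (b x y) * indicator A y \<partial>\<nu>) - (\<integral>\<^sup>+y. ennreal (c1 * b v y) * indicator A y \<partial>\<nu>)"
      using \<delta>\<psi>[OF that] e1[OF that] by simp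
    also have "\<dots> = (\<integral>\<^sup>+y. ennreal (b x y) * indicator A y - ennreal (c1 * b v y) * indicator A y \<partial>\<nu>)"
      using that nu(2) fin[OF that]
      by (intro nn_integral_diff[symmetric]) (auto intro!: mult_right_mono ennreal_leI c1_le)
    also have "\<dots> = (\<integral>\<^sup>+y. ennreal (b x y - c1 * b v y) * indicator A y \<partial>\<nu>)"
      using c1(1) b_pos by (intro nn_integral_cong) (auto simp: ennreal_minus less_imp_le split: split_indicator)
    finally show ?thesis .
  qed
  have rz: "r z \<in> borel_measurable killed_space" for z
    using rM[OF measurable_const measurable_ident, of z] by (simp only: space_killed_space UNIV_I id_apply simp_thms)
  have split: "(\<integral>\<^sup>+y. ennreal (if d then r z y else 1 - r z y) * indicator A y \<partial>killed (kernel_power B m) z)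
    = split_kernel (kernel_power B m) ?\<delta> ?\<psi> z d A" if A: "A \<in> sets killed_space" for z d A
  proof -
    note rz[of z, measurable]
    have mA: "(\<lambda>y. ennreal (if d then r z y else 1 - r z y) * indicator A y) \<in> borel_measurable killed_space"
    proof -
      have "(\<lambda>y. ennreal (r z y) * indicator A y) \<in> borel_measurable killed_space"
        "(\<lambda>y. ennreal (1 - r z y) * indicator A y) \<in> borel_measurable killed_space"
        using A by measurable
      then show ?thesis by (cases d) simp_all
    qed
    have SA: "Some -` A \<in> sets borel" using A by (simp add: sets_killed_space)
    show ?thesis
    proof (cases z)
      case None
      then show ?thesis unfolding nn_integral_killed[OF K mA] by (simp add: split_kernel_def r_def)
    next
      case (Some x)
      have r_meas: "(\<lambda>y. ennreal (if d then r z (Some y) else 1 - r z (Some y)) * indicator (Some -` A) y) \<in> borel_measurable borel"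
        using measurable_compose[OF measurable_Some mA] by (simp add: indicator_def)
      have i: "indicator A (Some y) = (indicator (Some -` A) y :: ennreal)" for y by (simp add: indicator_def)
      have "(\<integral>\<^sup>+y. ennreal (if d then r z (Some y) else 1 - r z (Some y)) * indicator A (Some y) \<partial>kernel_power B m x)
        = (\<integral>\<^sup>+y. ennreal (b x y) * (ennreal (if d then r z (Some y) else 1 - r z (Some y)) * indicator (Some -` A) y) \<partial>\<nu>)"
        unfolding b_density i
        by (rule nn_integral_density)
           (use SA r_meas in \<open>simp_all add: measurable_cong_sets[OF nu(2) refl]\<close>)
      also have "\<dots> = (\<integral>\<^sup>+y. ennreal (if d then c1 * b v y else b x y - c1 * b v y) * indicator (Some -` A) y \<partial>\<nu>)"
      proof (intro nn_integral_cong)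
        fix y
        let ?t = "if d then r z (Some y) else 1 - r z (Some y)"
        have "b x y * ?t = (if d then c1 * b v y else b x y - c1 * b v y)"
          using b_pos[of x y] by (simp add: r_def Some right_diff_distrib)
        moreover have "ennreal (b x y) * ennreal ?t = ennreal (b x y * ?t)"
          using b_pos[of x y] r01[of z "Some y"] by (intro ennreal_mult[symmetric]) auto
        ultimately show "ennreal (b x y) * (ennreal ?t * indicator (Some -` A) y)
          = ennreal (if d then c1 * b v y else b x y - c1 * b v y) * indicator (Some -` A) y"
          by (simp only: mult.assoc[symmetric])
      qed
      moreover have "ennreal (if d then r z None else 1 - r z None) = (if d then 0 else 1)"
        by (simp add: r_def Some)
      ultimately show ?thesis
        unfolding nn_integral_killed[OF K mA] using \<delta>\<psi>[OF SA] diff[OF SA]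
        by (cases d) (simp_all add: Some split_kernel_def)
    qed
  qed
  have X_past: "X i \<in> past n \<rightarrow>\<^sub>M killed_space" if "i \<le> n" for i n
    unfolding X_def using comp_past[OF that] by measurable
  have D_past: "D k \<in> past (k * m) \<rightarrow>\<^sub>M count_space UNIV" for k
  proof -
    have [measurable]: "(\<lambda>\<omega>. snd (\<omega> (k * m))) \<in> borel_measurable (past (k * m))"
      using comp_past[of "k * m" "k * m"] by measurable
    have [measurable]: "(\<lambda>\<omega>. r (X ((k - 1) * m) \<omega>) (X (k * m) \<omega>)) \<in> borel_measurable (past (k * m))"
      by (intro rM X_past) simp_all
    show ?thesis unfolding D_def by measurable
  qed
  have H_law: "H \<in> sets (past n) \<Longrightarrow> H \<in> sets (law x)" for H n x
    using past_law[of x n] by (auto simp: subalgebra_def)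
  have X_law: "X n \<in> law x \<rightarrow>\<^sub>M killed_space" for n x
    by (rule measurable_from_subalg[OF past_law X_past[OF order_refl]])
  have D_law: "D k \<in> law x \<rightarrow>\<^sub>M count_space UNIV" for k x
    by (rule measurable_from_subalg[OF past_law D_past])
  have "split_chain B m ?\<delta> ?\<psi> law past X D"
  proof (rule split_chain.intro)
    show "prob_space (law x)" for x by (rule prob_space_law)
    show "subalgebra (law x) (past n)" for x n by (rule past_law)
    show "sets (past n) \<subseteq> sets (past (Suc n))" for n by (rule past_mono)
    show "X n \<in> past n \<rightarrow>\<^sub>M killed_space" for n by (rule X_past) simp
    show "D k \<in> past (k * m) \<rightarrow>\<^sub>M count_space UNIV" for k by (rule D_past)
    show "AE \<omega> in law x. X 0 \<omega> = Some x" for x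
    proof -
      let ?f = "\<lambda>h :: nat \<Rightarrow> 'a option \<times> real. indicator (- {Some x}) (fst (h 0)) :: ennreal"
      have Sx: "- {Some x} \<in> sets killed_space"
        by (auto simp: sets_killed_space vimage_Compl vimage_def)
      have f: "?f \<in> borel_measurable (Pn (Suc 0))"
        using Sx by measurable
      have N: "{\<omega> \<in> space (law x). X 0 \<omega> \<noteq> Some x} \<in> sets (law x)"
        using measurable_sets[OF X_law Sx, of 0 x] by (simp add: space_law vimage_def)
      have "emeasure (law x) {\<omega> \<in> space (law x). X 0 \<omega> \<noteq> Some x} = (\<integral>\<^sup>+\<omega>. ?f (rs (Suc 0) \<omega>) \<partial>law x)"
        unfolding nn_integral_indicator[OF N, symmetric]
        by (intro nn_integral_cong) (auto simp: X_def space_law split: split_indicator)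
      also have "\<dots> = (\<integral>\<^sup>+\<omega>. (\<integral>\<^sup>+s. indicator (- {Some x}) (fst s) \<partial>chain_step B x 0 (rs 0 \<omega>)) \<partial>law x)"
        unfolding C_Suc[OF f] by simp
      also have "\<dots> = 0"
        unfolding chain_step_def nat.case using Sx
        by (subst nn_integral_pair_UM) (auto simp: nn_integral_return)
      finally show ?thesis
        using N by (subst AE_iff_measurable[OF N]) auto
    qed
    show "emeasure (law x) {\<omega> \<in> H. X (Suc n) \<omega> \<in> A} = (\<integral>\<^sup>+\<omega>\<in>H. killed_kernel B (X n \<omega>) A \<partial>law x)"
      if H: "H \<in> sets (past n)" and A: "A \<in> sets killed_space" for H n A x
    proof -
      obtain H' where H': "H' \<in> sets (Pn (Suc n))" "H = rs (Suc n) -` H'" using H by (rule pastE)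
      let ?f = "\<lambda>h s. indicator H' h * indicator A (fst s) :: ennreal"
      have f: "(\<lambda>(h, s). ?f h s) \<in> borel_measurable (Pn (Suc n) \<Otimes>\<^sub>M ext_space)"
        using H' A by measurable
      have HX: "{\<omega> \<in> H. X (Suc n) \<omega> \<in> A} \<in> sets (law x)"
        using sets.Int[OF H_law[OF H] measurable_sets[OF X_law A]]
        by (simp add: space_law vimage_def Int_def)
      have "emeasure (law x) {\<omega> \<in> H. X (Suc n) \<omega> \<in> A} = (\<integral>\<^sup>+\<omega>. ?f (rs (Suc n) \<omega>) (\<omega> (Suc n)) \<partial>law x)"
        unfolding nn_integral_indicator[OF HX, symmetric]
        by (intro nn_integral_cong) (auto simp: H' X_def split: split_indicator)
      also have "\<dots> = (\<integral>\<^sup>+\<omega>\<in>H. killed_kernel B (X n \<omega>) A \<partial>law x)"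
        unfolding one_step[OF f]
      proof (intro nn_integral_cong)
        fix \<omega> :: "nat \<Rightarrow> 'a option \<times> real"
        interpret U: prob_space unit_uniform by (rule prob_space_unit_uniform)
        have "(\<integral>\<^sup>+y. \<integral>\<^sup>+u. ?f (rs (Suc n) \<omega>) (y, u) \<partial>unit_uniform \<partial>killed B (fst (\<omega> n)))
          = (\<integral>\<^sup>+y. indicator H' (rs (Suc n) \<omega>) * indicator A y \<partial>killed B (fst (\<omega> n)))"
          using U.emeasure_space_1 by simp
        also have "\<dots> = killed_kernel B (X n \<omega>) A * indicator H \<omega>"
          using A by (simp add: H' X_def emeasure_killed[OF kernel] nn_integral_cmult split: split_indicator)
        finally show "(\<integral>\<^sup>+y. \<integral>\<^sup>+u. ?f (rs (Suc n) \<omega>) (y, u) \<partial>unit_uniform \<partial>killed B (fst (\<omega> n)))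
          = killed_kernel B (X n \<omega>) A * indicator H \<omega>" .
      qed
      finally show ?thesis .
    qed
    show "emeasure (law x) {\<omega> \<in> H. D (Suc k) \<omega> = d \<and> X (Suc k * m) \<omega> \<in> A}
        = (\<integral>\<^sup>+\<omega>\<in>H. split_kernel (kernel_power B m) ?\<delta> ?\<psi> (X (k * m) \<omega>) d A \<partial>law x)"
      if H: "H \<in> sets (past (k * m))" and A: "A \<in> sets killed_space" for H k A x d
    proof -
      let ?n = "k * m"
      obtain H' where H': "H' \<in> sets (Pn (Suc ?n))" "H = rs (Suc ?n) -` H'" using H by (rule pastE)
      let ?f = "\<lambda>h s. indicator H' h * (of_bool ((snd s < r (fst (h ?n)) (fst s)) = d) * indicator A (fst s)) :: ennreal"
      have [measurable]: "(\<lambda>p. r (fst (fst p ?n)) (fst (snd p))) \<in> borel_measurable (Pn (Suc ?n) \<Otimes>\<^sub>M ext_space)"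
        by (rule rM) measurable
      have f: "(\<lambda>(h, s). ?f h s) \<in> borel_measurable (Pn (Suc ?n) \<Otimes>\<^sub>M ext_space)"
        unfolding split_beta' using H' A by measurable
      obtain j where j: "m = Suc j" using m by (cases m) auto
      have idx: "?n + Suc j = Suc k * m" by (simp add: j)
      have HX: "{\<omega> \<in> H. D (Suc k) \<omega> = d \<and> X (Suc k * m) \<omega> \<in> A} \<in> sets (law x)"
        using sets.Int[OF H_law[OF H] sets.Int[OF
            measurable_sets[OF D_law, of "{d}" "Suc k" x] measurable_sets[OF X_law A, of "Suc k * m" x]]]
        by (simp add: space_law vimage_def Int_def)
      have "emeasure (law x) {\<omega> \<in> H. D (Suc k) \<omega> = d \<and> X (Suc k * m) \<omega> \<in> A}
        = (\<integral>\<^sup>+\<omega>. ?f (rs (Suc ?n) \<omega>) (\<omega> (?n + Suc j)) \<partial>law x)"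
        unfolding nn_integral_indicator[OF HX, symmetric] idx
        by (intro nn_integral_cong) (auto simp: H' X_def D_def simp del: mult_Suc split: split_indicator)
      also have "\<dots> = (\<integral>\<^sup>+\<omega>\<in>H. split_kernel (kernel_power B m) ?\<delta> ?\<psi> (X ?n \<omega>) d A \<partial>law x)"
        unfolding many_steps[OF f] unfolding j[symmetric]
      proof (intro nn_integral_cong)
        fix \<omega> :: "nat \<Rightarrow> 'a option \<times> real"
        let ?z = "fst (\<omega> ?n)"
        note rz[of ?z, measurable]
        have "(\<integral>\<^sup>+u. ?f (rs (Suc ?n) \<omega>) (y, u) \<partial>unit_uniform)
          = indicator H \<omega> * (ennreal (if d then r ?z y else 1 - r ?z y) * indicator A y)" for y
        proof -
          have "(\<integral>\<^sup>+u. ?f (rs (Suc ?n) \<omega>) (y, u) \<partial>unit_uniform)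
            = (\<integral>\<^sup>+u. (indicator H \<omega> * indicator A y) * of_bool ((u < r ?z y) = d) \<partial>unit_uniform)"
            by (intro nn_integral_cong) (auto simp: H' split: split_indicator)
          also have "\<dots> = (indicator H \<omega> * indicator A y) * (\<integral>\<^sup>+u. of_bool ((u < r ?z y) = d) \<partial>unit_uniform)"
            by (rule nn_integral_cmult) (cases d; measurable)
          finally show ?thesis
            unfolding UM_less[OF r01] by (simp add: ac_simps)
        qed
        then have "(\<integral>\<^sup>+y. \<integral>\<^sup>+u. ?f (rs (Suc ?n) \<omega>) (y, u) \<partial>unit_uniform \<partial>killed (kernel_power B m) ?z)
          = indicator H \<omega> * (\<integral>\<^sup>+y. ennreal (if d then r ?z y else 1 - r ?z y) * indicator A y \<partial>killed (kernel_power B m) ?z)"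
          using A by (simp add: nn_integral_cmult)
        then show "(\<integral>\<^sup>+y. \<integral>\<^sup>+u. ?f (rs (Suc ?n) \<omega>) (y, u) \<partial>unit_uniform \<partial>killed (kernel_power B m) ?z)
          = split_kernel (kernel_power B m) ?\<delta> ?\<psi> (X ?n \<omega>) d A * indicator H \<omega>"
          unfolding split[OF A] X_def by (simp add: mult.commute)
      qed
      finally show ?thesis .
    qed
  qed
  then show ?thesis by blast
qed

end

theory Submission
  imports Defs
begin

text \<open>
  Let \<open>R = B\<^sup>m - \<delta>\<psi>\<close>, a nonnegative kernel. The split chain gives \<open>P\<^sub>x(\<tau> = k, T > k m) = \<delta> R\<^bsup>k-1\<^esup>1(x)\<close>, so
  with \<open>s = e\<^sup>\<theta>\<close> the objects of the theorem are \<open>u = \<Sum>k\<ge>1. s\<^sup>k \<delta> R\<^bsup>k-1\<^esup>1\<close> and \<open>\<eta> = \<Sum>j\<ge>0. s\<^sup>j \<psi>R\<^sup>j\<close>, and the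
  equation for \<open>\<theta>\<close> is \<open>\<psi>u = 1\<close>. It follows that \<open>u = \<delta>s + sRu\<close>, hence \<open>sB\<^sup>mu = u\<close>, and dually
  \<open>s\<eta>B\<^sup>m = \<eta>\<close>; moreover \<open>u\<close> lies between two positive constants since \<open>Rf \<le> \<kappa> \<psi>f\<close> for a constant \<open>\<kappa>\<close>.

  No renewal theorem is needed: \<open>B\<^sup>m \<ge> \<delta>\<psi>\<close> makes \<open>g \<mapsto> sB\<^sup>mg\<close> shrink the interval
  \<open>\<alpha>u \<le> g \<le> \<beta>u\<close> by a fixed factor \<open>1 - \<epsilon>\<close>, so \<open>s\<^sup>qB\<^bsup>qm\<^esup>g\<close> converges to \<open>(\<eta>g / \<eta>u) u\<close>. Applying the functional
  \<open>\<eta>B\<close> instead of \<open>\<eta>\<close> gives \<open>\<eta>B = \<gamma>\<eta>\<close> with \<open>\<gamma>\<^sup>m = 1/s\<close>, and writing \<open>n = qm + k\<close> with \<open>k < m\<close> and taking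
  \<open>g = B\<^sup>k1\<^sub>C\<close> covers all \<open>n\<close>.
\<close>


section \<open>The root of the regeneration equation\<close>

text \<open>The sum of the first \<open>n\<close> terms is at most the sum of the first
  \<open>p\<close> terms plus \<open>q\<close> times itself. Solving for it gives a bound
  independent of \<open>n\<close>.\<close>

lemma summable_of_decay:
  fixes t :: "nat \<Rightarrow> real"
  assumes nonneg: "\<And>k. 0 \<le> t k" and decay: "\<And>k. t (k + p) \<le> q * t k"
    and q: "0 \<le> q" "q < 1"
  shows "summable t"
proof (rule summableI_nonneg_bounded)
  show "sum t {..<n} \<le> sum t {..<p} / (1 - q)" for n
  proof -
    have "sum t {..<n} \<le> sum t {..<p + n}"
      by (intro sum_mono2 nonneg) auto
    also have "\<dots> = sum t {..<p} + (\<Sum>k<n. t (k + p))"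
      by (induction n) (auto simp: add_ac)
    also have "\<dots> \<le> sum t {..<p} + q * sum t {..<n}"
      using decay by (auto simp: sum_distrib_left intro!: sum_mono)
    finally show ?thesis using q by (simp add: field_simps)
  qed
qed (rule nonneg)

text \<open>The root is the largest \<open>s\<close> with \<open>d s G(s) \<le> 1\<close>, where \<open>G(s) = \<Sum>k. g k s ^ k\<close>. Convergence of \<open>G(s)\<close>
  forces \<open>a s (g N s ^ N) < 1\<close> for some \<open>N\<close>; this persists slightly to the right of \<open>s\<close>, and by
  submultiplicativity \<open>G\<close> converges there. Hence \<open>G\<close> is continuous at \<open>s\<close>, which gives equality.\<close>

lemma powser_regeneration_root:
  fixes g :: "nat \<Rightarrow> real"
  assumes g: "\<And>k. 0 \<le> g k" "g 0 = 1"
    and sub: "\<And>j k. g (j + Suc k) \<le> a * g j * g k" and a: "0 \<le> a"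
    and d: "0 < d" and le: "\<And>n. d * (\<Sum>k<n. g k) \<le> 1"
  obtains s where "1 \<le> s" "summable (\<lambda>k. g k * s ^ k)" "d * s * (\<Sum>k. g k * s ^ k) = 1"
    "summable (\<lambda>k. real (Suc k) * g k * s ^ k)"
proof -
  \<comment> \<open>Partial sums make each condition a polynomial inequality, so \<open>T\<close> is
    closed and no convergence is presupposed.\<close>
  define T where "T = {s. 1 \<le> s \<and> (\<forall>n. d * s * (\<Sum>k<n. g k * s ^ k) \<le> 1)}"
  have T1: "1 \<in> T" using le by (simp add: T_def)
  \<comment> \<open>The one-term partial sum, with \<open>g 0 = 1\<close>, already bounds
    \<open>T\<close>.\<close>
  have ub: "s \<le> 1 / d" if "s \<in> T" for s
  proof -
    have "d * s * (\<Sum>k<Suc 0. g k * s ^ k) \<le> 1" using that by (simp only: T_def mem_Collect_eq)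
    then show ?thesis using g(2) d by (simp add: field_simps)
  qed
  then have bdd: "bdd_above T" by (rule bdd_aboveI)
  have "T = {1..} \<inter> (\<Inter>n. {s. d * s * (\<Sum>k<n. g k * s ^ k) \<le> 1})"
    by (auto simp: T_def)
  moreover have "closed \<dots>"
    by (intro closed_Int closed_INT closed_atLeast ballI closed_Collect_le continuous_intros)
  ultimately have "closed T" by simp
  define s where "s = Sup T"
  have sT: "s \<in> T"
    unfolding s_def using T1 bdd \<open>closed T\<close> by (intro closed_contains_Sup) auto
  then have s1: "1 \<le> s" and part: "d * s * (\<Sum>k<n. g k * s ^ k) \<le> 1" for n
    by (auto simp: T_def)
  have ds: "0 < d * s" using d s1 by simp
  have summ: "summable (\<lambda>k. g k * s ^ k)"
  proof (rule summableI_nonneg_bounded)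
    show "(\<Sum>k<n. g k * s ^ k) \<le> 1 / (d * s)" for n
      using part[of n] ds by (simp add: field_simps)
  qed (use g s1 in auto)
  have "(\<lambda>k. a * s * (g k * s ^ k)) \<longlonglongrightarrow> a * s * 0"
    by (intro tendsto_mult tendsto_const summable_LIMSEQ_zero summ)
  then have "\<forall>\<^sub>F k in sequentially. a * s * (g k * s ^ k) < 1"
    by (rule order_tendstoD) simp
  then obtain N where N: "a * s * (g N * s ^ N) < 1"
    by (auto simp: eventually_sequentially)
  have "((\<lambda>z. a * z * (g N * z ^ N)) \<longlongrightarrow> a * s * (g N * s ^ N)) (at_right s)"
    by (intro tendsto_intros)
  from order_tendstoD(2)[OF this N] obtain z0 where
    z0: "s < z0" "\<And>z. s < z \<Longrightarrow> z < z0 \<Longrightarrow> a * z * (g N * z ^ N) < 1"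
    by (auto simp: eventually_at_right_field)
  define z where "z = (s + z0) / 2"
  have z: "s < z" "z < z0" using z0(1) by (auto simp: z_def)
  then have q: "a * z * (g N * z ^ N) < 1" by (rule z0(2))
  have zpos: "0 < z" using z s1 by simp
  \<comment> \<open>By \<open>sub\<close>, shifting the index by \<open>Suc N\<close> multiplies a
    term by at most \<open>a * z * (g N * z ^ N)\<close>, which is below one.\<close>
  have summz: "summable (\<lambda>k. g k * z ^ k)"
  proof (rule summable_of_decay[where p = "Suc N" and q = "a * z * (g N * z ^ N)"])
    show "g (k + Suc N) * z ^ (k + Suc N) \<le> a * z * (g N * z ^ N) * (g k * z ^ k)" for k
      using mult_right_mono[OF sub[of k N], of "z ^ (k + Suc N)"] zpos
      by (simp add: power_add mult_ac)
  qed (use q zpos g a in auto)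
  have inz: "summable (\<lambda>k. g k * w ^ k)" if "\<bar>w\<bar> < z" for w
    using powser_inside[OF summz, of w] that zpos by simp
  have cont: "isCont (\<lambda>w. d * w * (\<Sum>k. g k * w ^ k)) s"
    using isCont_powser[OF summz, of s] z s1 by (intro isCont_mult) auto
  have le1: "d * s * (\<Sum>k. g k * s ^ k) \<le> 1"
    using suminf_le_const[OF summ, of "1 / (d * s)"] part ds by (simp add: field_simps)
  have eq1: "d * s * (\<Sum>k. g k * s ^ k) = 1"
  proof (rule ccontr)
    assume "\<not> ?thesis"
    with le1 have "d * s * (\<Sum>k. g k * s ^ k) < 1" by simp
    moreover have "((\<lambda>w. d * w * (\<Sum>k. g k * w ^ k)) \<longlongrightarrow> d * s * (\<Sum>k. g k * s ^ k)) (at_right s)"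
      using cont unfolding isCont_def by (rule tendsto_within_subset) auto
    ultimately have "\<forall>\<^sub>F w in at_right s. d * w * (\<Sum>k. g k * w ^ k) < 1"
      by (rule order_tendstoD(2)[rotated])
    moreover have "\<forall>\<^sub>F w in at_right s. s < w \<and> w < z"
      using z by (auto simp: eventually_at_right_field)
    ultimately have "\<forall>\<^sub>F w in at_right s. s < w \<and> w < z \<and> d * w * (\<Sum>k. g k * w ^ k) < 1"
      by eventually_elim auto
    then obtain w where w: "s < w" "w < z" "d * w * (\<Sum>k. g k * w ^ k) < 1"
      using eventually_happens'[OF trivial_limit_at_right_real] by blast
    have "w \<in> T"
      unfolding T_def
    proof (clarify, intro conjI allI)
      fix n
      have "(\<Sum>k<n. g k * w ^ k) \<le> (\<Sum>k. g k * w ^ k)"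
        using w s1 g by (intro sum_le_suminf inz) auto
      then have "d * w * (\<Sum>k<n. g k * w ^ k) \<le> d * w * (\<Sum>k. g k * w ^ k)"
        using d w s1 by (intro mult_left_mono) auto
      with w show "d * w * (\<Sum>k<n. g k * w ^ k) \<le> 1" by simp
    qed (use w s1 in auto)
    with bdd have "w \<le> s" unfolding s_def by (rule cSup_upper[rotated])
    with w show False by simp
  qed
  \<comment> \<open>These are the coefficients of \<open>w * G(w)\<close>, so
    \<open>diffs c k\<close> is \<open>Suc k * g k\<close>. Convergence beyond \<open>s\<close>
    permits termwise differentiation at \<open>s\<close>.\<close>
  define c where "c k = (case k of 0 \<Rightarrow> 0 | Suc k \<Rightarrow> g k)" for k
  have "summable (\<lambda>n. diffs c n * s ^ n)"
  proof (rule termdiff_converges)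
    show "norm s < z" using z s1 by simp
    show "summable (\<lambda>n. c n * w ^ n)" if "norm w < z" for w
    proof (subst summable_Suc_iff[symmetric])
      show "summable (\<lambda>n. c (Suc n) * w ^ Suc n)"
        using summable_mult[OF inz[of w], of w] that by (simp add: c_def mult_ac)
    qed
  qed
  then have "summable (\<lambda>k. real (Suc k) * g k * s ^ k)"
    by (simp add: diffs_def c_def)
  with s1 summ eq1 show thesis by (rule that)
qed

section \<open>The kernel and its remainder as operators on functions\<close>

text \<open>The bounds on the density ratio appear pointwise: \<open>b_lower\<close> makes the
  remainder kernel nonnegative, \<open>b_upper\<close> dominates it by a multiple of
  \<open>\<psi>\<close>.\<close>

locale doeblin_kernel =
  fixes B :: "'a::topological_space \<Rightarrow> 'a measure"
    and \<nu> :: "'a measure" and m :: nat and b :: "'a \<Rightarrow> 'a \<Rightarrow> real"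
    and v :: 'a and c1 c2 :: real
  assumes kernel: "B \<in> borel \<rightarrow>\<^sub>M subprob_algebra borel"
    and prob_nu: "prob_space \<nu>" and sets_nu [measurable_cong, simp]: "sets \<nu> = sets borel"
    and m_ge_1: "1 \<le> m"
    and b_meas: "(\<lambda>(x, y). b x y) \<in> borel_measurable (borel \<Otimes>\<^sub>M borel)"
    and b_pos: "0 < b x y"
    and b_density: "kernel_power B m x = density \<nu> (\<lambda>y. ennreal (b x y))"
    and c1_pos: "0 < c1" and b_lower: "c1 * b v y \<le> b x y" and b_upper: "b x y \<le> c2 * b v y"
begin

abbreviation \<delta> :: real where "\<delta> \<equiv> delta \<nu> b v c1"
abbreviation \<psi> :: "'a measure" where "\<psi> \<equiv> psi \<nu> b v"

text \<open>\<open>Kop\<close>, \<open>Rop\<close> and \<open>Bop\<close> are the actions of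
  \<open>B^m\<close>, \<open>B^m - \<delta>\<psi>\<close> and \<open>B\<close> on functions. Values
  in \<open>ennreal\<close> avoid integrability questions, and the densities in \<open>Kop\<close>
  and \<open>Rop\<close> make Fubini with respect to \<open>\<nu>\<close> available.\<close>

definition Kop :: "('a \<Rightarrow> ennreal) \<Rightarrow> 'a \<Rightarrow> ennreal" where
  "Kop f x = (\<integral>\<^sup>+y. ennreal (b x y) * f y \<partial>\<nu>)"

definition Rop :: "('a \<Rightarrow> ennreal) \<Rightarrow> 'a \<Rightarrow> ennreal" where
  "Rop f x = (\<integral>\<^sup>+y. ennreal (b x y - c1 * b v y) * f y \<partial>\<nu>)"

definition Bop :: "('a \<Rightarrow> ennreal) \<Rightarrow> 'a \<Rightarrow> ennreal" where
  "Bop f x = (\<integral>\<^sup>+y. f y \<partial>B x)"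

sublocale nu: prob_space \<nu> by (rule prob_nu)

lemma space_nu [simp]: "space \<nu> = UNIV"
  using sets_eq_imp_space_eq[OF sets_nu] by simp

lemma sets_psi [measurable_cong, simp]: "sets \<psi> = sets borel"
  by (simp add: psi_def)

lemma space_psi [simp]: "space \<psi> = UNIV"
  by (simp add: psi_def)

lemma sets_B [measurable_cong, simp]: "sets (B x) = sets borel"
  by (rule B_sets[OF kernel])

lemma space_B [simp]: "space (B x) = UNIV"
  by (rule B_sets[OF kernel])

lemmas sets_power = B_sets[OF kernel_power_measurable[OF kernel]]

lemma measurable_b [measurable]: "b x \<in> borel_measurable borel"
  using measurable_compose[OF measurable_Pair1'[of x borel borel] b_meas] by simp

lemma measurable_b_comp [measurable (raw)]:
  assumes "f \<in> M \<rightarrow>\<^sub>M borel" "g \<in> M \<rightarrow>\<^sub>M borel"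
  shows "(\<lambda>x. b (f x) (g x)) \<in> borel_measurable M"
  using measurable_compose[OF measurable_Pair[OF assms] b_meas] by simp

lemma measurable_Rop [measurable (raw)]:
  assumes [measurable]: "f \<in> borel_measurable borel"
  shows "Rop f \<in> borel_measurable borel"
  unfolding Rop_def by measurable

lemma measurable_Kop [measurable (raw)]:
  assumes [measurable]: "f \<in> borel_measurable borel"
  shows "Kop f \<in> borel_measurable borel"
  unfolding Kop_def by measurable

lemma measurable_Bop [measurable (raw)]:
  assumes [measurable]: "f \<in> borel_measurable borel"
  shows "Bop f \<in> borel_measurable borel"
  unfolding Bop_def by (rule nn_integral_measurable_subprob_algebra2[OF _ kernel]) measurable

lemma measurable_Rop_power [measurable (raw)]:
  "f \<in> borel_measurable borel \<Longrightarrow> (Rop ^^ n) f \<in> borel_measurable borel"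
  by (induction n) auto

lemma measurable_Kop_power [measurable (raw)]:
  "f \<in> borel_measurable borel \<Longrightarrow> (Kop ^^ n) f \<in> borel_measurable borel"
  by (induction n) auto

lemma measurable_Bop_power [measurable (raw)]:
  "f \<in> borel_measurable borel \<Longrightarrow> (Bop ^^ n) f \<in> borel_measurable borel"
  by (induction n) auto

section \<open>Powers of the kernel as iterated operators\<close>

lemma nn_integral_kernel_power:
  assumes [measurable]: "f \<in> borel_measurable borel"
  shows "(\<integral>\<^sup>+y. f y \<partial>kernel_power B n x) = (Bop ^^ n) f x"
proof (induction n arbitrary: x)
  case 0
  then show ?case by (simp add: nn_integral_return)
next
  case (Suc n)
  have "(\<integral>\<^sup>+y. f y \<partial>(B x \<bind> kernel_power B n)) = (\<integral>\<^sup>+y. (\<integral>\<^sup>+z. f z \<partial>kernel_power B n y) \<partial>B x)"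
    by (rule nn_integral_bind[where B=borel])
      (use kernel_power_measurable[OF kernel, of n] in \<open>auto simp: measurable_cong_sets[OF sets_B refl]\<close>)
  then show ?case by (simp add: Suc Bop_def)
qed

text \<open>The density hypothesis enters here; it lets estimates made through \<open>b\<close> be
  used for iterates of \<open>Bop\<close>.\<close>

lemma Kop_eq_Bop_power:
  assumes [measurable]: "f \<in> borel_measurable borel"
  shows "Kop f = (Bop ^^ m) f"
proof
  fix x
  have "Kop f x = (\<integral>\<^sup>+y. f y \<partial>kernel_power B m x)"
    unfolding b_density Kop_def by (rule nn_integral_density[symmetric]) auto
  then show "Kop f x = (Bop ^^ m) f x"
    by (simp add: nn_integral_kernel_power)
qed

lemma Kop_power_eq:
  assumes [measurable]: "f \<in> borel_measurable borel"
  shows "(Kop ^^ q) f = (Bop ^^ (m * q)) f"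
proof (induction q)
  case (Suc q)
  then show ?case by (simp add: Kop_eq_Bop_power funpow_add)
qed simp

lemma emeasure_kernel_power:
  "C \<in> sets borel \<Longrightarrow> emeasure (kernel_power B n x) C = (Bop ^^ n) (indicator C) x"
  using nn_integral_kernel_power[of "indicator C" n x] by (simp add: sets_power)

lemma Kop_1_le: "Kop (\<lambda>_. 1) x \<le> 1"
  using nn_integral_kernel_power[of "\<lambda>_. 1" m x] B_le[OF kernel_power_measurable[OF kernel], of m x UNIV]
  by (simp add: Kop_eq_Bop_power sets_power)

section \<open>The regeneration measure and the two-sided density bounds\<close>

definition \<beta> :: real where "\<beta> = (\<integral>y. b v y \<partial>\<nu>)"

text \<open>The integral of \<open>b v\<close> is the mass of \<open>B^m(v, .)\<close>, which is at
  most one.\<close>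

lemma integrable_b: "integrable \<nu> (b v)"
  using Kop_1_le[of v] b_pos unfolding Kop_def
  by (intro integrableI_nonneg) (auto simp: less_imp_le top_unique intro: le_less_trans)

lemma \<beta>_pos: "0 < \<beta>"
  using integrable_b b_pos nu.emeasure_space_1 nu.integral_less_AE_space[of "\<lambda>_. 0" "b v"]
  by (simp add: \<beta>_def)

lemma \<delta>_eq: "\<delta> = c1 * \<beta>"
  by (simp add: delta_def \<beta>_def)

lemma \<delta>_pos: "0 < \<delta>"
  using c1_pos \<beta>_pos by (simp add: \<delta>_eq)

lemma c1_le_c2: "c1 \<le> c2"
  using order_trans[OF b_lower[of v v] b_upper[of v v]] b_pos[of v v] by simp

lemma nn_integral_psi:
  assumes [measurable]: "f \<in> borel_measurable borel"
  shows "ennreal \<beta> * (\<integral>\<^sup>+y. f y \<partial>\<psi>) = (\<integral>\<^sup>+y. ennreal (b v y) * f y \<partial>\<nu>)"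
proof -
  have "(\<integral>\<^sup>+y. f y \<partial>\<psi>) = (\<integral>\<^sup>+y. ennreal (b v y / \<beta>) * f y \<partial>\<nu>)"
    unfolding psi_def \<beta>_def[symmetric] by (rule nn_integral_density) auto
  then have "ennreal \<beta> * (\<integral>\<^sup>+y. f y \<partial>\<psi>) = (\<integral>\<^sup>+y. ennreal \<beta> * (ennreal (b v y / \<beta>) * f y) \<partial>\<nu>)"
    by (simp add: nn_integral_cmult)
  also have "\<dots> = (\<integral>\<^sup>+y. ennreal (b v y) * f y \<partial>\<nu>)"
    using \<beta>_pos b_pos by (simp add: mult.assoc[symmetric] ennreal_mult[symmetric] less_imp_le)
  finally show ?thesis .
qed

lemma nn_integral_psi_1: "(\<integral>\<^sup>+y. 1 \<partial>\<psi>) = 1"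
proof -
  have "(\<integral>\<^sup>+y. ennreal (b v y) * 1 \<partial>\<nu>) = ennreal \<beta>"
    using integrable_b b_pos unfolding \<beta>_def by (simp add: nn_integral_eq_integral less_imp_le)
  then have "ennreal \<beta> * (\<integral>\<^sup>+y. 1 \<partial>\<psi>) = ennreal \<beta> * 1"
    using nn_integral_psi[of "\<lambda>_. 1"] by simp
  then show ?thesis
    using \<beta>_pos by (subst (asm) ennreal_mult_cancel_left) auto
qed

sublocale psi: prob_space \<psi>
  using nn_integral_psi_1 by (intro prob_spaceI) simp

text \<open>The density \<open>b x y\<close> is the sum of \<open>c1 * b v y\<close>, which
  integrates to \<open>\<delta>\<psi>\<close>, and a remainder. By \<open>b_lower\<close> the
  remainder is nonnegative, so \<open>ennreal\<close> does not truncate it.\<close>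

lemma Kop_split:
  assumes [measurable]: "f \<in> borel_measurable borel"
  shows "Kop f x = ennreal \<delta> * (\<integral>\<^sup>+y. f y \<partial>\<psi>) + Rop f x"
proof -
  have e: "ennreal (b x y) = ennreal (c1 * b v y) + ennreal (b x y - c1 * b v y)" for y
    using b_lower c1_pos b_pos[of v y] by (subst ennreal_plus[symmetric]) (auto simp: less_imp_le)
  have "Kop f x = (\<integral>\<^sup>+y. ennreal (c1 * b v y) * f y \<partial>\<nu>) + Rop f x"
    unfolding Kop_def Rop_def e distrib_right by (rule nn_integral_add) auto
  also have "(\<integral>\<^sup>+y. ennreal (c1 * b v y) * f y \<partial>\<nu>) = ennreal c1 * (\<integral>\<^sup>+y. ennreal (b v y) * f y \<partial>\<nu>)"
    using c1_pos b_pos by (subst nn_integral_cmult[symmetric]) (auto simp: ennreal_mult less_imp_le mult.assoc)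
  also have "\<dots> = ennreal \<delta> * (\<integral>\<^sup>+y. f y \<partial>\<psi>)"
    using c1_pos \<beta>_pos by (simp add: nn_integral_psi[symmetric] \<delta>_eq ennreal_mult mult.assoc)
  finally show ?thesis .
qed

definition \<kappa> :: real where "\<kappa> = (c2 - c1) * \<beta>"

lemma \<kappa>_nonneg: "0 \<le> \<kappa>"
  using c1_le_c2 \<beta>_pos by (simp add: \<kappa>_def)

text \<open>The remainder density is at most \<open>(c2 - c1) * b v y\<close>, and
  \<open>b v y \<nu>(dy)\<close> is \<open>\<beta>\<psi>(dy)\<close>. The bound is uniform in
  \<open>x\<close>; it yields submultiplicativity of \<open>tail\<close> and boundedness of
  \<open>u\<close>.\<close>

lemma Rop_le:
  assumes [measurable]: "f \<in> borel_measurable borel"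
  shows "Rop f x \<le> ennreal \<kappa> * (\<integral>\<^sup>+y. f y \<partial>\<psi>)"
proof -
  have "Rop f x \<le> (\<integral>\<^sup>+y. ennreal (c2 - c1) * (ennreal (b v y) * f y) \<partial>\<nu>)"
    unfolding Rop_def
  proof (intro nn_integral_mono)
    fix y
    have "ennreal (b x y - c1 * b v y) \<le> ennreal ((c2 - c1) * b v y)"
      using b_upper[of x y] by (intro ennreal_leI) (simp add: left_diff_distrib)
    also have "\<dots> = ennreal (c2 - c1) * ennreal (b v y)"
      using c1_le_c2 b_pos[of v y] by (intro ennreal_mult) auto
    finally show "ennreal (b x y - c1 * b v y) * f y \<le> ennreal (c2 - c1) * (ennreal (b v y) * f y)"
      by (simp add: mult_right_mono mult.assoc[symmetric])
  qed
  also have "\<dots> = ennreal (c2 - c1) * (ennreal \<beta> * (\<integral>\<^sup>+y. f y \<partial>\<psi>))"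
    by (simp add: nn_integral_cmult nn_integral_psi)
  also have "\<dots> = ennreal \<kappa> * (\<integral>\<^sup>+y. f y \<partial>\<psi>)"
    using c1_le_c2 \<beta>_pos by (simp add: \<kappa>_def ennreal_mult mult.assoc)
  finally show ?thesis .
qed

section \<open>Order and linearity properties of the operators\<close>

lemma Rop_mono: "(\<And>y. f y \<le> g y) \<Longrightarrow> Rop f x \<le> Rop g x"
  unfolding Rop_def by (intro nn_integral_mono mult_left_mono) auto

lemma Rop_add:
  assumes [measurable]: "f \<in> borel_measurable borel" "g \<in> borel_measurable borel"
  shows "Rop (\<lambda>y. f y + g y) = (\<lambda>x. Rop f x + Rop g x)"
  unfolding Rop_def distrib_left by (simp add: nn_integral_add)

lemma Rop_cmult:
  assumes [measurable]: "f \<in> borel_measurable borel"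
  shows "Rop (\<lambda>y. c * f y) = (\<lambda>x. c * Rop f x)"
  unfolding Rop_def by (simp add: nn_integral_cmult[symmetric] mult.left_commute)

lemma Rop_suminf:
  assumes [measurable]: "\<And>i. f i \<in> borel_measurable borel"
  shows "Rop (\<lambda>y. \<Sum>i. f i y) = (\<lambda>x. \<Sum>i. Rop (f i) x)"
  unfolding Rop_def by (simp add: nn_integral_suminf[symmetric])

lemma Rop_power_mono: "(\<And>y. f y \<le> g y) \<Longrightarrow> (Rop ^^ n) f x \<le> (Rop ^^ n) g x"
  by (induction n arbitrary: x) (auto intro: Rop_mono)

lemma Rop_power_add:
  assumes [measurable]: "f \<in> borel_measurable borel" "g \<in> borel_measurable borel"
  shows "(Rop ^^ n) (\<lambda>y. f y + g y) = (\<lambda>x. (Rop ^^ n) f x + (Rop ^^ n) g x)"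
  by (induction n) (simp_all add: Rop_add)

lemma Rop_power_cmult:
  assumes [measurable]: "f \<in> borel_measurable borel"
  shows "(Rop ^^ n) (\<lambda>y. c * f y) = (\<lambda>x. c * (Rop ^^ n) f x)"
  by (induction n) (simp_all add: Rop_cmult)

lemma Bop_mono: "(\<And>y. f y \<le> g y) \<Longrightarrow> Bop f x \<le> Bop g x"
  unfolding Bop_def by (intro nn_integral_mono) auto

lemma Bop_cmult:
  assumes [measurable]: "f \<in> borel_measurable borel"
  shows "Bop (\<lambda>y. c * f y) = (\<lambda>x. c * Bop f x)"
  unfolding Bop_def by (simp add: nn_integral_cmult)

lemma Bop_power_mono: "(\<And>y. f y \<le> g y) \<Longrightarrow> (Bop ^^ n) f x \<le> (Bop ^^ n) g x"
  by (induction n arbitrary: x) (auto intro: Bop_mono)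

lemma Bop_power_1_le: "(Bop ^^ n) (\<lambda>_. 1) x \<le> 1"
  using nn_integral_kernel_power[of "\<lambda>_. 1" n x] B_le[OF kernel_power_measurable[OF kernel], of n x UNIV]
  by (simp add: sets_power)

lemma Kop_add:
  assumes [measurable]: "f \<in> borel_measurable borel" "g \<in> borel_measurable borel"
  shows "Kop (\<lambda>y. f y + g y) = (\<lambda>x. Kop f x + Kop g x)"
  unfolding Kop_def distrib_left by (simp add: nn_integral_add)

lemma Kop_cmult:
  assumes [measurable]: "f \<in> borel_measurable borel"
  shows "Kop (\<lambda>y. c * f y) = (\<lambda>x. c * Kop f x)"
  unfolding Kop_def by (simp add: nn_integral_cmult[symmetric] mult.left_commute)

section \<open>Tail masses and existence of the root\<close>

lemma measurable_one: "(\<lambda>_. 1 :: ennreal) \<in> borel_measurable borel"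
  by simp

text \<open>For the split chain started from \<open>\<psi>\<close>, this is the probability of
  \<open>\<tau> > k\<close> and \<open>T > k m\<close>.\<close>

definition tail :: "nat \<Rightarrow> ennreal" where
  "tail k = (\<integral>\<^sup>+x. (Rop ^^ k) (\<lambda>_. 1) x \<partial>\<psi>)"

text \<open>Substochasticity gives \<open>\<delta> + R1 \<le> 1\<close>. Applying \<open>R^n\<close>
  and integrating against \<open>\<psi>\<close> gives
  \<open>\<delta> tail n + tail (Suc n) \<le> tail n\<close>, which telescopes.\<close>

lemma sum_tail_le: "ennreal \<delta> * (\<Sum>k<n. tail k) + tail n \<le> 1"
proof (induction n)
  case 0
  then show ?case by (simp add: tail_def nn_integral_psi_1 del: nn_integral_const)
next
  case (Suc n)
  have "ennreal \<delta> * (Rop ^^ n) (\<lambda>_. 1) x + (Rop ^^ Suc n) (\<lambda>_. 1) x \<le> (Rop ^^ n) (\<lambda>_. 1) x" for x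
  proof -
    have "ennreal \<delta> * (Rop ^^ n) (\<lambda>_. 1) x + (Rop ^^ Suc n) (\<lambda>_. 1) x
        = (Rop ^^ n) (\<lambda>y. ennreal \<delta> + Rop (\<lambda>_. 1) y) x"
      using Rop_power_cmult[of "\<lambda>_. 1" n "ennreal \<delta>"]
      by (simp add: Rop_power_add funpow_Suc_right del: funpow.simps)
    also have "\<dots> \<le> (Rop ^^ n) (\<lambda>_. 1) x"
      by (rule Rop_power_mono)
        (use Kop_1_le in \<open>simp add: Kop_split[OF measurable_one] psi.emeasure_space_1[simplified]\<close>)
    finally show ?thesis .
  qed
  then have "(\<integral>\<^sup>+x. ennreal \<delta> * (Rop ^^ n) (\<lambda>_. 1) x + (Rop ^^ Suc n) (\<lambda>_. 1) x \<partial>\<psi>) \<le> tail n"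
    unfolding tail_def by (intro nn_integral_mono)
  then have "ennreal \<delta> * tail n + tail (Suc n) \<le> tail n"
    unfolding tail_def by (subst (asm) nn_integral_add) (auto simp: nn_integral_cmult simp del: funpow.simps)
  then have "ennreal \<delta> * (\<Sum>k<n. tail k) + (ennreal \<delta> * tail n + tail (Suc n))
      \<le> ennreal \<delta> * (\<Sum>k<n. tail k) + tail n"
    by (rule add_left_mono)
  also have "\<dots> \<le> 1" by (rule Suc)
  finally show ?case by (simp add: distrib_left add.assoc)
qed

lemma tail_le_1: "tail n \<le> 1"
  using sum_tail_le[of n] by (rule order_trans[rotated]) simp

text \<open>\<open>Rop_le\<close> bounds \<open>R^(k+1) 1\<close> by the constant
  \<open>\<kappa> tail k\<close>; the remaining \<open>j\<close> applications of \<open>R\<close>,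
  integrated against \<open>\<psi>\<close>, contribute \<open>tail j\<close>.\<close>

lemma tail_submult: "tail (j + Suc k) \<le> ennreal \<kappa> * tail j * tail k"
proof -
  have "(Rop ^^ (j + Suc k)) (\<lambda>_. 1) x \<le> ennreal \<kappa> * tail k * (Rop ^^ j) (\<lambda>_. 1) x" for x
  proof -
    have "(Rop ^^ (j + Suc k)) (\<lambda>_. 1) x = (Rop ^^ j) (Rop ((Rop ^^ k) (\<lambda>_. 1))) x"
      by (simp only: funpow_add funpow.simps o_apply)
    also have "\<dots> \<le> (Rop ^^ j) (\<lambda>_. (ennreal \<kappa> * tail k) * 1) x"
      unfolding tail_def mult_1_right by (intro Rop_power_mono Rop_le measurable_Rop_power measurable_one)
    also have "\<dots> = ennreal \<kappa> * tail k * (Rop ^^ j) (\<lambda>_. 1) x"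
      by (subst Rop_power_cmult) auto
    finally show ?thesis .
  qed
  then have "tail (j + Suc k) \<le> (\<integral>\<^sup>+x. ennreal \<kappa> * tail k * (Rop ^^ j) (\<lambda>_. 1) x \<partial>\<psi>)"
    unfolding tail_def[of "j + Suc k"] by (intro nn_integral_mono)
  also have "\<dots> = ennreal \<kappa> * tail k * tail j"
    unfolding tail_def[of j] by (rule nn_integral_cmult) auto
  finally show ?thesis by (simp add: mult_ac)
qed

text \<open>The series are those of the two conditions on \<open>\<theta>\<close> with
  \<open>s = exp \<theta>\<close>, since \<open>\<delta> tail k\<close> is the probability under
  \<open>\<psi>\<close> of \<open>\<tau> = k + 1\<close> and \<open>T > \<tau> m\<close>. The real
  power series lemma applies because every \<open>tail k\<close> is at most one.\<close>

lemma regeneration_root: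
  obtains s :: real where "1 \<le> s" "(\<Sum>k. ennreal (s ^ Suc k) * (ennreal \<delta> * tail k)) = 1"
    "(\<Sum>k. ennreal (real (Suc k) * s ^ Suc k) * (ennreal \<delta> * tail k)) < \<infinity>"
proof -
  define g where "g k = enn2real (tail k)" for k
  have g: "tail k = ennreal (g k)" for k
    unfolding g_def by (rule ennreal_enn2real[symmetric]) (rule le_less_trans[OF tail_le_1], simp)
  have g0: "0 \<le> g k" for k by (simp add: g_def)
  have d: "0 \<le> \<delta>" using \<delta>_pos by simp
  obtain s where s: "1 \<le> s" "summable (\<lambda>k. g k * s ^ k)" "\<delta> * s * (\<Sum>k. g k * s ^ k) = 1"
    "summable (\<lambda>k. real (Suc k) * g k * s ^ k)"
  proof (rule powser_regeneration_root[of g \<kappa> \<delta>])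
    show "g 0 = 1"
      using nn_integral_psi_1 by (simp add: g_def tail_def del: nn_integral_const)
    show "g (j + Suc k) \<le> \<kappa> * g j * g k" for j k
      using tail_submult[of j k] \<kappa>_nonneg g0 by (simp add: g ennreal_mult[symmetric] del: add_Suc_right)
    show "\<delta> * (\<Sum>k<n. g k) \<le> 1" for n
    proof -
      have "ennreal \<delta> * (\<Sum>k<n. tail k) \<le> 1"
        using sum_tail_le[of n] by (rule order_trans[rotated]) simp
      then show ?thesis
        using g0 d by (simp add: g sum_nonneg ennreal_mult[symmetric] ennreal_le_1 sum_ennreal)
    qed
  qed (use g0 \<kappa>_nonneg \<delta>_pos in auto)
  show thesis
  proof (rule that[OF s(1)])
    have e: "ennreal (s ^ Suc k) * (ennreal \<delta> * tail k) = ennreal (\<delta> * s * (g k * s ^ k))" for k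
      using s(1) g0 d by (simp add: g ennreal_mult[symmetric] mult_ac)
    show "(\<Sum>k. ennreal (s ^ Suc k) * (ennreal \<delta> * tail k)) = 1"
      unfolding e using s g0 d
      by (subst suminf_ennreal2) (auto simp: suminf_mult intro: summable_mult)
    have e: "ennreal (real (Suc k) * s ^ Suc k) * (ennreal \<delta> * tail k)
        = ennreal (\<delta> * s * (real (Suc k) * g k * s ^ k))" for k
      using s(1) g0 d by (simp add: g ennreal_mult[symmetric] mult_ac del: of_nat_Suc)
    show "(\<Sum>k. ennreal (real (Suc k) * s ^ Suc k) * (ennreal \<delta> * tail k)) < \<infinity>"
      unfolding e using s g0 d
      by (subst suminf_ennreal2) (auto intro!: summable_mult simp del: of_nat_Suc)
  qed
qed

end

section \<open>From extended nonnegative to real inequalities\<close>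

lemma ennreal_eq_add_imp:
  assumes "ennreal p = ennreal q + X" "0 \<le> q" "0 \<le> p"
  shows "X = ennreal (p - q)"
proof (cases X)
  case (real r)
  then show ?thesis using assms by (simp flip: ennreal_plus)
qed (use assms in simp)

lemma mult_enn2real_le:
  assumes "ennreal l * X \<le> Y" "0 \<le> l" "Y < \<top>"
  shows "l * enn2real X \<le> enn2real Y"
  using enn2real_mono[OF assms(1,3)] assms(2) by (simp add: enn2real_mult)

lemma enn2real_le_mult:
  assumes "Y \<le> ennreal r * X" "0 \<le> r" "X < \<top>"
  shows "enn2real Y \<le> r * enn2real X"
  using enn2real_mono[OF assms(1)] assms(2,3) by (simp add: enn2real_mult ennreal_mult_less_top)

context doeblin_kernel
begin

text \<open>The density of \<open>\<psi>R\<^sup>j\<close> with respect to \<open>\<nu>\<close>, where \<open>R(x,dy) = B\<^sup>m(x,dy) - \<delta>\<psi>(dy)\<close>.\<close>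

primrec density_power :: "nat \<Rightarrow> 'a \<Rightarrow> ennreal" where
  "density_power 0 = (\<lambda>y. ennreal (b v y / \<beta>))"
| "density_power (Suc j) = (\<lambda>y. \<integral>\<^sup>+x. density_power j x * ennreal (b x y - c1 * b v y) \<partial>\<nu>)"

lemma measurable_density_power [measurable]: "density_power j \<in> borel_measurable borel"
proof (induction j)
  case (Suc j)
  note Suc [measurable]
  show ?case unfolding density_power.simps by measurable
qed simp

text \<open>Fubini moves one factor \<open>R\<close> from the density to the test function. The
  induction hypothesis is then needed at \<open>Rop f\<close>, so \<open>f\<close> is kept
  arbitrary.\<close>

lemma nn_integral_density_power:
  assumes "f \<in> borel_measurable borel"
  shows "(\<integral>\<^sup>+y. density_power j y * f y \<partial>\<nu>) = (\<integral>\<^sup>+y. (Rop ^^ j) f y \<partial>\<psi>)"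
  using assms
proof (induction j arbitrary: f)
  case 0
  note 0 [measurable]
  show ?case
    unfolding psi_def \<beta>_def[symmetric]
    by (simp, rule nn_integral_density[symmetric]) auto
next
  case (Suc j)
  note Suc.prems [measurable]
  interpret pair_sigma_finite \<nu> \<nu> ..
  have "(\<integral>\<^sup>+y. density_power (Suc j) y * f y \<partial>\<nu>)
      = (\<integral>\<^sup>+y. (\<integral>\<^sup>+x. density_power j x * ennreal (b x y - c1 * b v y) * f y \<partial>\<nu>) \<partial>\<nu>)"
    by (subst nn_integral_multc) auto
  also have "\<dots> = (\<integral>\<^sup>+x. (\<integral>\<^sup>+y. density_power j x * (ennreal (b x y - c1 * b v y) * f y) \<partial>\<nu>) \<partial>\<nu>)"
    unfolding mult.assoc by (rule Fubini') measurable
  also have "\<dots> = (\<integral>\<^sup>+x. density_power j x * Rop f x \<partial>\<nu>)"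
    unfolding Rop_def by (intro nn_integral_cong nn_integral_cmult) measurable
  also have "\<dots> = (\<integral>\<^sup>+y. (Rop ^^ Suc j) f y \<partial>\<psi>)"
    by (subst Suc.IH) (auto simp: funpow_Suc_right simp del: funpow.simps)
  finally show ?case .
qed

end

section \<open>Eigenfunction, eigenmeasure and contraction\<close>

text \<open>Here \<open>s\<close> plays the role of \<open>exp \<theta>\<close>, and
  \<open>s_root\<close> becomes the normalization \<open>\<psi>u = 1\<close> in
  \<open>psi_u\<close>.\<close>

locale doeblin_eigen = doeblin_kernel +
  fixes s :: real
  assumes s_pos: "0 < s"
    and s_root: "(\<Sum>k. ennreal (s ^ Suc k) * (ennreal \<delta> * tail k)) = 1"
begin

definition u :: "'a \<Rightarrow> ennreal" where
  "u x = (\<Sum>k. ennreal (s ^ Suc k) * (ennreal \<delta> * (Rop ^^ k) (\<lambda>_. 1) x))"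

text \<open>The density form makes \<open>\<eta>\<close> a measure by construction;
  \<open>E_eq\<close> recovers the series of \<open>\<psi>R^j\<close>.\<close>

definition \<eta> :: "'a measure" where
  "\<eta> = density \<nu> (\<lambda>y. \<Sum>j. ennreal (s ^ j) * density_power j y)"

definition E :: "('a \<Rightarrow> ennreal) \<Rightarrow> ennreal" where
  "E f = (\<integral>\<^sup>+x. f x \<partial>\<eta>)"

lemma sets_eta [measurable_cong, simp]: "sets \<eta> = sets borel"
  by (simp add: \<eta>_def)

lemma measurable_u [measurable]: "u \<in> borel_measurable borel"
  unfolding u_def[abs_def] by measurable

lemma E_eq:
  assumes [measurable]: "f \<in> borel_measurable borel"
  shows "E f = (\<Sum>j. ennreal (s ^ j) * (\<integral>\<^sup>+x. (Rop ^^ j) f x \<partial>\<psi>))"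
proof -
  have "E f = (\<integral>\<^sup>+y. (\<Sum>j. ennreal (s ^ j) * (density_power j y * f y)) \<partial>\<nu>)"
    unfolding E_def \<eta>_def
    by (subst nn_integral_density) (auto simp: ennreal_suminf_multc[symmetric] mult.assoc simp del: ennreal_suminf_multc)
  also have "\<dots> = (\<Sum>j. ennreal (s ^ j) * (\<integral>\<^sup>+x. (Rop ^^ j) f x \<partial>\<psi>))"
    by (simp add: nn_integral_suminf nn_integral_cmult nn_integral_density_power)
  finally show ?thesis .
qed

lemma E_indicator: "C \<in> sets borel \<Longrightarrow> E (indicator C) = emeasure \<eta> C"
  unfolding E_def by (rule nn_integral_indicator) simp

lemma E_mono: "(\<And>x. f x \<le> g x) \<Longrightarrow> E f \<le> E g"
  unfolding E_def by (rule nn_integral_mono)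

lemma E_add:
  "f \<in> borel_measurable borel \<Longrightarrow> g \<in> borel_measurable borel \<Longrightarrow> E (\<lambda>x. f x + g x) = E f + E g"
  unfolding E_def by (rule nn_integral_add) auto

lemma E_cmult: "f \<in> borel_measurable borel \<Longrightarrow> E (\<lambda>x. c * f x) = c * E f"
  unfolding E_def by (rule nn_integral_cmult) auto

lemma suminf_Suc_ennreal: "(\<Sum>k. f k) = f 0 + (\<Sum>k. f (Suc k) :: ennreal)"
  using suminf_offset[of f 1] by (simp add: add.commute)

text \<open>The term \<open>k = 0\<close> of the series is \<open>\<delta> * s\<close>; each later
  term carries a factor \<open>sR\<close>.\<close>

lemma u_Rop: "u x = ennreal (\<delta> * s) + ennreal s * Rop u x"
proof -
  have "Rop u x = (\<Sum>k. ennreal (s ^ Suc k) * (ennreal \<delta> * (Rop ^^ Suc k) (\<lambda>_. 1) x))"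
    unfolding u_def[abs_def] by (subst Rop_suminf) (auto simp: Rop_cmult)
  then have "ennreal s * Rop u x = (\<Sum>k. ennreal (s ^ Suc (Suc k)) * (ennreal \<delta> * (Rop ^^ Suc k) (\<lambda>_. 1) x))"
    using s_pos by (simp add: ennreal_suminf_cmult[symmetric] ennreal_mult mult.assoc del: ennreal_suminf_cmult)
  then show ?thesis
    using s_pos \<delta>_pos by (subst u_def, subst suminf_Suc_ennreal) (simp add: ennreal_mult mult.commute)
qed

lemma psi_u: "(\<integral>\<^sup>+x. u x \<partial>\<psi>) = 1"
proof -
  have "(\<integral>\<^sup>+x. u x \<partial>\<psi>) = (\<Sum>k. ennreal (s ^ Suc k) * (ennreal \<delta> * tail k))"
    unfolding u_def tail_def
    by (subst nn_integral_suminf, measurable) (intro suminf_cong, simp add: nn_integral_cmult)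
  then show ?thesis by (simp only: s_root)
qed

text \<open>Since \<open>\<psi>u = 1\<close>, the \<open>\<delta>\<psi>\<close> part of
  \<open>sKu\<close> is exactly the constant that \<open>u_Rop\<close> adds to
  \<open>sRu\<close>.\<close>

lemma Kop_u: "ennreal s * Kop u x = u x"
  using s_pos \<delta>_pos by (simp add: Kop_split psi_u distrib_left ennreal_mult mult.commute u_Rop[of x])

lemma E_Rop:
  assumes [measurable]: "f \<in> borel_measurable borel"
  shows "E f = (\<integral>\<^sup>+x. f x \<partial>\<psi>) + ennreal s * E (Rop f)"
proof -
  have "ennreal s * E (Rop f) = (\<Sum>j. ennreal (s ^ Suc j) * (\<integral>\<^sup>+x. (Rop ^^ Suc j) f x \<partial>\<psi>))"
    using s_pos
    by (subst E_eq) (auto simp: ennreal_suminf_cmult[symmetric] ennreal_mult mult.assoc funpow_Suc_right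
        simp del: ennreal_suminf_cmult funpow.simps)
  then show ?thesis
    by (subst E_eq, simp, subst suminf_Suc_ennreal) simp
qed

text \<open>Term by term, this is the root equation again; it fixes the total mass of
  \<open>\<eta>\<close>.\<close>

lemma E_1: "ennreal (\<delta> * s) * E (\<lambda>_. 1) = 1"
proof -
  have "ennreal (\<delta> * s) * E (\<lambda>_. 1) = (\<Sum>k. ennreal (\<delta> * s) * (ennreal (s ^ k) * tail k))"
    by (simp add: E_eq tail_def)
  also have "\<dots> = (\<Sum>k. ennreal (s ^ Suc k) * (ennreal \<delta> * tail k))"
    using s_pos \<delta>_pos by (intro suminf_cong) (simp add: ennreal_mult mult_ac)
  finally show ?thesis by (simp only: s_root)
qed

text \<open>Dual to \<open>Kop_u\<close>: by \<open>E_1\<close> the \<open>\<delta>\<psi>\<close>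
  part contributes exactly \<open>\<psi>f\<close>, the first summand in
  \<open>E_Rop\<close>.\<close>

lemma E_Kop:
  assumes [measurable]: "f \<in> borel_measurable borel"
  shows "E (\<lambda>x. ennreal s * Kop f x) = E f"
proof -
  have "E (\<lambda>x. ennreal s * Kop f x)
      = E (\<lambda>x. (ennreal (\<delta> * s) * (\<integral>\<^sup>+x. f x \<partial>\<psi>)) * 1 + ennreal s * Rop f x)"
    using s_pos \<delta>_pos by (simp add: Kop_split distrib_left ennreal_mult mult_ac)
  also have "\<dots> = (ennreal (\<delta> * s) * E (\<lambda>_. 1)) * (\<integral>\<^sup>+x. f x \<partial>\<psi>) + ennreal s * E (Rop f)"
    by (subst E_add, simp, simp, subst E_cmult, simp, subst E_cmult) (auto simp: mult_ac)
  also have "\<dots> = E f"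
    by (simp add: E_1 E_Rop[of f])
  finally show ?thesis .
qed

section \<open>Uniform bounds on the eigenfunction\<close>

definition M :: real where "M = \<delta> * s + s * \<kappa>"

lemma \<delta>s_pos: "0 < \<delta> * s"
  using s_pos \<delta>_pos by simp

lemma M_ge: "\<delta> * s \<le> M"
  using s_pos \<kappa>_nonneg by (simp add: M_def)

lemma M_pos: "0 < M"
  using M_ge \<delta>s_pos by simp

lemma u_le: "u x \<le> ennreal M"
proof -
  have "u x \<le> ennreal (\<delta> * s) + ennreal s * (ennreal \<kappa> * 1)"
    unfolding u_Rop[of x] psi_u[symmetric] by (intro add_left_mono mult_left_mono Rop_le) auto
  also have "\<dots> = ennreal M"
    using s_pos \<kappa>_nonneg \<delta>s_pos by (simp add: M_def ennreal_mult)
  finally show ?thesis .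
qed

lemma u_ge: "ennreal (\<delta> * s) \<le> u x"
  unfolding u_Rop[of x] by simp

text \<open>The lower bound on \<open>u\<close> turns bounded functions into functions below a
  multiple of \<open>u\<close>, the starting point of the contraction.\<close>

lemma const_le_u: "0 \<le> c \<Longrightarrow> ennreal c \<le> ennreal (c / (\<delta> * s)) * u x"
proof -
  assume "0 \<le> c"
  then have "ennreal c = ennreal (c / (\<delta> * s)) * ennreal (\<delta> * s)"
    using \<delta>s_pos s_pos \<delta>_pos by (auto simp: ennreal_mult[symmetric])
  also have "\<dots> \<le> ennreal (c / (\<delta> * s)) * u x"
    by (intro mult_left_mono u_ge) simp
  finally show ?thesis .
qed

lemma E_1_finite: "E (\<lambda>_. 1) < \<top>"
proof (rule ccontr)
  assume "\<not> ?thesis"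
  then have "E (\<lambda>_. 1) = \<top>" using less_top by blast
  with E_1 have "ennreal (\<delta> * s) * \<top> = 1" by simp
  with \<delta>s_pos show False by (auto simp: ennreal_mult_top split: if_splits)
qed

lemma E_finite:
  assumes "\<And>x. f x \<le> ennreal c"
  shows "E f < \<top>"
proof -
  have "E f \<le> E (\<lambda>_. ennreal c * 1)"
    using assms by (intro E_mono) simp
  also have "\<dots> = ennreal c * E (\<lambda>_. 1)"
    by (rule E_cmult) simp
  also have "\<dots> < \<top>"
    using E_1_finite by (simp add: ennreal_mult_less_top)
  finally show ?thesis .
qed

lemma E_u_ge: "1 \<le> E u"
proof -
  have "E (\<lambda>_. ennreal (\<delta> * s) * 1) \<le> E u"
    using u_ge by (intro E_mono) simp
  then show ?thesis
    by (subst (asm) E_cmult) (auto simp: E_1)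
qed

abbreviation Er :: "('a \<Rightarrow> ennreal) \<Rightarrow> real" where "Er f \<equiv> enn2real (E f)"

lemma Er: "(\<And>x. f x \<le> ennreal c) \<Longrightarrow> ennreal (Er f) = E f"
  using E_finite[of f c] by simp

lemma Er_u_ge: "1 \<le> Er u"
proof -
  have "ennreal 1 \<le> ennreal (Er u)"
    using E_u_ge unfolding Er[OF u_le] by simp
  then show ?thesis by (subst (asm) ennreal_le_iff) auto
qed

section \<open>Contraction of intervals of multiples of \<open>u\<close>\<close>

definition \<epsilon> :: real where "\<epsilon> = \<delta> * s / M"

lemma \<epsilon>: "0 < \<epsilon>" "\<epsilon> \<le> 1"
  using M_pos M_ge \<delta>s_pos by (auto simp: \<epsilon>_def)

text \<open>\<open>sKw\<close> is at least \<open>\<delta> s \<psi>w = \<epsilon> M \<psi>w\<close>,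
  and \<open>u\<close> is at most \<open>M\<close>.\<close>

lemma Kop_minorized:
  assumes [measurable]: "w \<in> borel_measurable borel"
  shows "ennreal \<epsilon> * (\<integral>\<^sup>+y. w y \<partial>\<psi>) * u x \<le> ennreal s * Kop w x"
proof -
  have "ennreal \<epsilon> * (\<integral>\<^sup>+y. w y \<partial>\<psi>) * u x \<le> ennreal \<epsilon> * (\<integral>\<^sup>+y. w y \<partial>\<psi>) * ennreal M"
    by (intro mult_left_mono u_le) simp
  also have "\<dots> = ennreal (\<delta> * s) * (\<integral>\<^sup>+y. w y \<partial>\<psi>)"
  proof -
    have "ennreal \<epsilon> * ennreal M = ennreal (\<delta> * s)"
      using M_pos \<epsilon> by (simp add: ennreal_mult[symmetric]) (simp add: \<epsilon>_def)
    then show ?thesis by (simp add: mult_ac)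
  qed
  also have "\<dots> \<le> ennreal s * Kop w x"
    using s_pos \<delta>_pos by (simp add: Kop_split distrib_left ennreal_mult mult_ac)
  finally show ?thesis .
qed

text \<open>Both \<open>g - \<alpha>u\<close> and \<open>\<beta>'u - g\<close> are nonnegative, so the minorization raises the lower and lowers the
  upper multiple of \<open>u\<close> by a total of \<open>\<epsilon>(\<beta>' - \<alpha>)\<close>; here \<open>\<psi>u = 1\<close> is used.\<close>

lemma contraction_step:
  fixes \<alpha> \<beta>' :: real
  assumes [measurable]: "g \<in> borel_measurable borel"
    and ab: "0 \<le> \<alpha>" "\<alpha> \<le> \<beta>'"
    and lo: "\<And>x. ennreal \<alpha> * u x \<le> g x" and up: "\<And>x. g x \<le> ennreal \<beta>' * u x"
  shows "\<exists>l r. 0 \<le> l \<and> l \<le> r \<and> r - l = (1 - \<epsilon>) * (\<beta>' - \<alpha>) \<and>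
    (\<forall>x. ennreal l * u x \<le> ennreal s * Kop g x \<and> ennreal s * Kop g x \<le> ennreal r * u x)"
proof -
  let ?P = "\<lambda>f. \<integral>\<^sup>+y. f y \<partial>\<psi>"
  have Pu: "?P (\<lambda>x. c * u x) = c" for c
    by (simp add: nn_integral_cmult psi_u)
  have P1: "ennreal \<alpha> \<le> ?P g" "?P g \<le> ennreal \<beta>'"
    using nn_integral_mono[of \<psi> "\<lambda>x. ennreal \<alpha> * u x" g] nn_integral_mono[of \<psi> g "\<lambda>x. ennreal \<beta>' * u x"]
      lo up by (auto simp: Pu)
  define p where "p = enn2real (?P g)"
  have pP: "?P g = ennreal p"
    using P1(2) unfolding p_def by (auto simp: top_unique less_top intro!: ennreal_enn2real[symmetric] le_less_trans[OF P1(2)])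
  have p: "\<alpha> \<le> p" "p \<le> \<beta>'" "0 \<le> p"
    using P1 ab unfolding pP by (auto simp: p_def)
  have ufin: "u x < \<top>" for x
    using u_le[of x] by (rule le_less_trans) simp
  define w where "w x = g x - ennreal \<alpha> * u x" for x
  have [measurable]: "w \<in> borel_measurable borel" unfolding w_def[abs_def] by measurable
  \<comment> \<open>Differences in \<open>ennreal\<close> truncate, so \<open>g\<close> is recovered
    as a sum; \<open>lo\<close> guarantees that nothing is lost.\<close>
  have w: "g = (\<lambda>x. ennreal \<alpha> * u x + w x)"
    unfolding w_def by (rule ext, subst add.commute, rule diff_add_cancel_ennreal[OF lo, symmetric])
  have "ennreal p = ennreal \<alpha> + ?P w"
    unfolding pP[symmetric] w by (subst nn_integral_add) (auto simp: Pu)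
  then have Pw: "?P w = ennreal (p - \<alpha>)"
    using ab p by (intro ennreal_eq_add_imp) auto
  define w' where "w' x = ennreal \<beta>' * u x - g x" for x
  have [measurable]: "w' \<in> borel_measurable borel" unfolding w'_def[abs_def] by measurable
  have w': "(\<lambda>x. ennreal \<beta>' * u x) = (\<lambda>x. g x + w' x)"
    unfolding w'_def by (rule ext, subst add.commute, rule diff_add_cancel_ennreal[OF up, symmetric])
  have "ennreal \<beta>' = ?P (\<lambda>x. ennreal \<beta>' * u x)"
    by (simp only: Pu)
  also have "\<dots> = ennreal p + ?P w'"
    unfolding w' pP[symmetric] by (rule nn_integral_add) auto
  finally have "ennreal \<beta>' = ennreal p + ?P w'" .
  then have Pw': "?P w' = ennreal (\<beta>' - p)"
    using ab p by (intro ennreal_eq_add_imp) auto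
  \<comment> \<open>The \<open>\<psi>\<close>-masses of \<open>w\<close> and \<open>w'\<close> are
    \<open>p - \<alpha>\<close> and \<open>\<beta>' - p\<close>. The minorization moves each end
    inwards by \<open>\<epsilon>\<close> times its mass.\<close>
  define l r where "l = \<alpha> + \<epsilon> * (p - \<alpha>)" and "r = \<beta>' - \<epsilon> * (\<beta>' - p)"
  have rl: "r - l = (1 - \<epsilon>) * (\<beta>' - \<alpha>)"
    by (simp add: l_def r_def algebra_simps)
  have "0 \<le> (1 - \<epsilon>) * (\<beta>' - \<alpha>)" using \<epsilon> ab by simp
  with rl have lr: "l \<le> r" by simp
  have l0: "0 \<le> l" using \<epsilon> ab p by (simp add: l_def)
  have lower: "ennreal l * u x \<le> ennreal s * Kop g x" for x
  proof -
    have "ennreal l * u x = ennreal \<alpha> * u x + ennreal \<epsilon> * ?P w * u x"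
      unfolding Pw using \<epsilon> ab p by (simp add: l_def distrib_right ennreal_mult)
    also have "\<dots> \<le> ennreal \<alpha> * u x + ennreal s * Kop w x"
      by (intro add_left_mono Kop_minorized) measurable
    also have "\<dots> = ennreal \<alpha> * (ennreal s * Kop u x) + ennreal s * Kop w x"
      by (simp only: Kop_u)
    also have "\<dots> = ennreal s * Kop g x"
      by (subst w) (simp add: Kop_add Kop_cmult distrib_left mult.left_commute)
    finally show ?thesis .
  qed
  have upper: "ennreal s * Kop g x \<le> ennreal r * u x" for x
  proof -
    \<comment> \<open>The correction is added on both sides and cancelled at the end, which is
      legitimate because \<open>u x\<close> is finite.\<close>
    have "ennreal s * Kop g x + ennreal (\<epsilon> * (\<beta>' - p)) * u x \<le> ennreal s * Kop g x + ennreal s * Kop w' x"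
      using Kop_minorized[of w' x] \<epsilon> p unfolding Pw'
      by (intro add_left_mono) (simp add: ennreal_mult)
    also have "\<dots> = ennreal s * Kop (\<lambda>x. ennreal \<beta>' * u x) x"
      unfolding w' by (simp add: Kop_add distrib_left)
    also have "\<dots> = ennreal \<beta>' * (ennreal s * Kop u x)"
      by (simp add: Kop_cmult mult.left_commute)
    also have "\<dots> = ennreal \<beta>' * u x"
      by (simp only: Kop_u)
    also have "\<dots> = ennreal r * u x + ennreal (\<epsilon> * (\<beta>' - p)) * u x"
      using \<epsilon> p l0 lr by (simp add: distrib_right[symmetric] ennreal_plus[symmetric] r_def del: ennreal_plus)
    finally show ?thesis
      using ufin[of x]
      by (simp only: add.commute[of _ "ennreal (\<epsilon> * (\<beta>' - p)) * u x"] ennreal_add_left_cancel_le)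
         (auto simp: ennreal_mult_eq_top_iff)
  qed
  show ?thesis using rl lr l0 lower upper by blast
qed

text \<open>Iterates \<open>contraction_step\<close> from the interval with ends \<open>0\<close>
  and \<open>c\<close>. The ends depend on \<open>n\<close> but not on \<open>x\<close>; invariance
  of \<open>E\<close> later places \<open>Er g / Er u\<close> between them, which identifies the
  limit.\<close>

lemma contraction:
  fixes c :: real
  assumes [measurable]: "g \<in> borel_measurable borel"
    and c: "0 \<le> c" and up: "\<And>x. g x \<le> ennreal c * u x"
  obtains l r where "0 \<le> l" "l \<le> r" "r - l = (1 - \<epsilon>) ^ n * c"
    "\<And>x. ennreal l * u x \<le> ennreal (s ^ n) * (Kop ^^ n) g x"
    "\<And>x. ennreal (s ^ n) * (Kop ^^ n) g x \<le> ennreal r * u x"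
proof -
  have "\<exists>l r. 0 \<le> l \<and> l \<le> r \<and> r - l = (1 - \<epsilon>) ^ n * c \<and>
    (\<forall>x. ennreal l * u x \<le> ennreal (s ^ n) * (Kop ^^ n) g x \<and> ennreal (s ^ n) * (Kop ^^ n) g x \<le> ennreal r * u x)"
  proof (induction n)
    case 0
    show ?case using c up by (intro exI[of _ 0] exI[of _ c]) simp
  next
    case (Suc n)
    then obtain l r where lr: "0 \<le> l" "l \<le> r" "r - l = (1 - \<epsilon>) ^ n * c"
      "\<And>x. ennreal l * u x \<le> ennreal (s ^ n) * (Kop ^^ n) g x"
      "\<And>x. ennreal (s ^ n) * (Kop ^^ n) g x \<le> ennreal r * u x" by auto
    have "ennreal s * Kop (\<lambda>x. ennreal (s ^ n) * (Kop ^^ n) g x) x = ennreal (s ^ Suc n) * (Kop ^^ Suc n) g x" for x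
      using s_pos by (simp add: Kop_cmult ennreal_mult mult.assoc)
    with contraction_step[OF _ lr(1,2,4,5)] lr(3) show ?case
      by (simp add: mult.assoc del: funpow.simps power_Suc) (simp add: mult.assoc)
  qed
  then show thesis using that by blast
qed

section \<open>The one-step decay rate\<close>

lemma Bop_le_const:
  assumes [measurable]: "f \<in> borel_measurable borel" and "\<And>x. f x \<le> ennreal c"
  shows "(Bop ^^ n) f x \<le> ennreal c"
proof -
  have cm: "(Bop ^^ n) (\<lambda>_. ennreal c * 1) = (\<lambda>x. ennreal c * (Bop ^^ n) (\<lambda>_. 1) x)"
    by (induction n) (simp_all add: Bop_cmult)
  have "(Bop ^^ n) f x \<le> (Bop ^^ n) (\<lambda>_. ennreal c * 1) x"
    using assms(2) by (intro Bop_power_mono) simp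
  also have "\<dots> \<le> ennreal c * 1"
    unfolding cm by (intro mult_left_mono Bop_power_1_le) simp
  finally show ?thesis by simp
qed

lemma E_Kop_power:
  assumes [measurable]: "f \<in> borel_measurable borel"
  shows "E (\<lambda>x. ennreal (s ^ n) * (Kop ^^ n) f x) = E f"
proof (induction n)
  case (Suc n)
  have "ennreal (s ^ Suc n) * (Kop ^^ Suc n) f x = ennreal s * Kop (\<lambda>x. ennreal (s ^ n) * (Kop ^^ n) f x) x" for x
    using s_pos by (simp add: Kop_cmult ennreal_mult mult.assoc)
  then show ?case using Suc by (simp only:) (subst E_Kop, auto)
qed simp

text \<open>Both are powers of \<open>Bop\<close>, hence commute. This makes \<open>\<eta>B\<close>
  invariant under \<open>sB^m\<close>.\<close>

lemma Bop_Kop_power: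
  assumes [measurable]: "f \<in> borel_measurable borel"
  shows "Bop ((Kop ^^ n) f) = (Kop ^^ n) (Bop f)"
  by (simp add: Kop_power_eq funpow_swap1)

text \<open>The factor in \<open>\<eta>B = \<gamma>\<eta>\<close>, read off at the test function
  \<open>u\<close>.\<close>

definition \<gamma> :: real where "\<gamma> = Er (Bop u) / Er u"

text \<open>\<open>\<eta>\<close> and \<open>\<eta>B\<close> are both invariant under \<open>s B\<^sup>m\<close>, and the contraction makes such a measure unique up to a factor.\<close>

lemma Er_Bop:
  assumes [measurable]: "f \<in> borel_measurable borel" and c: "0 \<le> c" and f: "\<And>x. f x \<le> ennreal c"
  shows "Er (Bop f) = \<gamma> * Er f"
proof -
  have Bu: "Bop u x \<le> ennreal M" for x
    using Bop_le_const[OF _ u_le, where n=1] by simp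
  have Bf: "Bop f x \<le> ennreal c" for x
    using Bop_le_const[OF _ f, where n=1] by simp
  define c' where "c' = c / (\<delta> * s)"
  have c': "0 \<le> c'" using c \<delta>s_pos by (simp add: c'_def)
  have fu: "f x \<le> ennreal c' * u x" for x
    using order_trans[OF f const_le_u[OF c]] by (simp add: c'_def)
  \<comment> \<open>For every \<open>n\<close>, the interval from \<open>l\<close> to
    \<open>r\<close> controls \<open>f\<close> relative to \<open>u\<close> under both
    \<open>\<eta>\<close> and \<open>\<eta>B\<close>. Cross-multiplication avoids dividing by
    \<open>Er (Bop u)\<close>, whose positivity is not yet established.\<close>
  have key: "\<bar>Er (Bop f) * Er u - Er f * Er (Bop u)\<bar> \<le> (1 - \<epsilon>) ^ n * (c' * (Er u * Er (Bop u)))" for n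
  proof -
    obtain l r where lr: "0 \<le> l" "l \<le> r" "r - l = (1 - \<epsilon>) ^ n * c'"
      and lo: "\<And>x. ennreal l * u x \<le> ennreal (s ^ n) * (Kop ^^ n) f x"
      and up: "\<And>x. ennreal (s ^ n) * (Kop ^^ n) f x \<le> ennreal r * u x"
      using contraction[OF _ c' fu, of n] by auto
    have r0: "0 \<le> r" using lr by simp
    have "ennreal l * E u \<le> E f" "E f \<le> ennreal r * E u"
      using E_mono[of "\<lambda>x. ennreal l * u x", OF lo] E_mono[of _ "\<lambda>x. ennreal r * u x", OF up] by (simp_all add: E_Kop_power E_cmult)
    then have 1: "l * Er u \<le> Er f" "Er f \<le> r * Er u"
      using lr(1) r0 E_finite[OF f] E_finite[OF u_le]
      by (auto intro: mult_enn2real_le enn2real_le_mult)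
    have BL: "E (Bop (\<lambda>x. ennreal (s ^ n) * (Kop ^^ n) f x)) = E (Bop f)"
      by (simp add: Bop_cmult Bop_Kop_power E_Kop_power)
    have "ennreal l * E (Bop u) \<le> E (Bop f)" "E (Bop f) \<le> ennreal r * E (Bop u)"
      using E_mono[of "Bop (\<lambda>x. ennreal l * u x)", OF Bop_mono, OF lo]
        E_mono[of _ "Bop (\<lambda>x. ennreal r * u x)", OF Bop_mono, OF up]
      unfolding BL by (simp_all add: Bop_cmult E_cmult)
    then have 2: "l * Er (Bop u) \<le> Er (Bop f)" "Er (Bop f) \<le> r * Er (Bop u)"
      using lr(1) r0 E_finite[OF Bf] E_finite[OF Bu]
      by (auto intro: mult_enn2real_le enn2real_le_mult)
    let ?t = "Er u * Er (Bop u)"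
    have "l * ?t \<le> Er (Bop f) * Er u" "Er (Bop f) * Er u \<le> r * ?t"
      using mult_right_mono[OF 2(1), of "Er u"] mult_right_mono[OF 2(2), of "Er u"] by (auto simp: mult_ac)
    moreover have "l * ?t \<le> Er f * Er (Bop u)" "Er f * Er (Bop u) \<le> r * ?t"
      using mult_right_mono[OF 1(1), of "Er (Bop u)"] mult_right_mono[OF 1(2), of "Er (Bop u)"] by (auto simp: mult_ac)
    ultimately have "\<bar>Er (Bop f) * Er u - Er f * Er (Bop u)\<bar> \<le> r * ?t - l * ?t" by linarith
    also have "\<dots> = (1 - \<epsilon>) ^ n * (c' * ?t)"
      using lr(3) by (simp add: left_diff_distrib[symmetric])
    finally show ?thesis .
  qed
  have "(\<lambda>n. (1 - \<epsilon>) ^ n * (c' * (Er u * Er (Bop u)))) \<longlonglongrightarrow> 0 * (c' * (Er u * Er (Bop u)))"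
    using \<epsilon> by (intro tendsto_mult tendsto_const LIMSEQ_realpow_zero) auto
  then have "\<bar>Er (Bop f) * Er u - Er f * Er (Bop u)\<bar> \<le> 0 * (c' * (Er u * Er (Bop u)))"
    by (rule LIMSEQ_le_const) (use key in auto)
  then show ?thesis
    using Er_u_ge by (simp add: \<gamma>_def field_simps)
qed

lemma Er_Bop_power:
  assumes [measurable]: "f \<in> borel_measurable borel" and c: "0 \<le> c" and f: "\<And>x. f x \<le> ennreal c"
  shows "Er ((Bop ^^ n) f) = \<gamma> ^ n * Er f"
proof (induction n)
  case (Suc n)
  show ?case using Er_Bop[OF _ c Bop_le_const[OF _ f, where n=n]] Suc by simp
qed simp

lemma \<gamma>_nonneg: "0 \<le> \<gamma>"
  by (simp add: \<gamma>_def)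

text \<open>Two evaluations of \<open>Er (Kop u)\<close>: invariance of \<open>\<eta>\<close> gives
  \<open>Er u / s\<close>, and \<open>m\<close> steps of \<open>B\<close> give
  \<open>\<gamma> ^ m * Er u\<close>.\<close>

lemma \<gamma>_power_m: "\<gamma> ^ m = 1 / s"
proof -
  have "E u = ennreal s * E (Kop u)"
    using E_Kop[of u] by (simp add: E_cmult)
  then have "Er u = s * Er (Kop u)"
    using s_pos by (simp add: enn2real_mult)
  also have "Er (Kop u) = \<gamma> ^ m * Er u"
    using Er_Bop_power[OF _ _ u_le, where n=m] M_pos by (simp add: Kop_eq_Bop_power)
  finally show ?thesis using Er_u_ge s_pos by (simp add: field_simps)
qed

lemma \<gamma>_pos: "0 < \<gamma>"
proof -
  have "\<gamma> \<noteq> 0" using \<gamma>_power_m s_pos m_ge_1 by (auto simp: power_0_left)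
  with \<gamma>_nonneg show ?thesis by simp
qed

text \<open>Test \<open>\<eta>B = \<gamma>\<eta>\<close> on the constant \<open>1\<close>, which
  \<open>B\<close> does not increase. It later gives \<open>\<gamma> ^ m \<le> \<gamma> ^ k\<close>
  for remainders \<open>k < m\<close>.\<close>

lemma \<gamma>_le_1: "\<gamma> \<le> 1"
proof -
  have 1: "(1 :: ennreal) \<le> ennreal 1" by simp
  have "E (Bop (\<lambda>_. 1)) \<le> E (\<lambda>_. 1)"
    using Bop_power_1_le[of 1] by (intro E_mono) simp
  then have "Er (Bop (\<lambda>_. 1)) \<le> Er (\<lambda>_. 1)"
    using E_1_finite by (intro enn2real_mono) auto
  moreover have "Er (Bop (\<lambda>_. 1)) = \<gamma> * Er (\<lambda>_. 1)"
    by (rule Er_Bop[of _ 1]) auto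
  moreover have "0 < Er (\<lambda>_. 1)"
    using E_1 E_1_finite by (auto simp: enn2real_positive_iff intro!: gr_zeroI)
  ultimately show ?thesis by simp
qed

section \<open>Asymptotics along all times\<close>

lemma powr_eq: "(1 / s) powr (real n / real m) = \<gamma> ^ n"
proof -
  have "(1 / s) powr (real n / real m) = (\<gamma> powr real m) powr (real n / real m)"
    using \<gamma>_power_m \<gamma>_pos by (simp add: powr_realpow)
  also have "\<dots> = \<gamma> powr real n"
    using m_ge_1 by (simp add: powr_powr)
  finally show ?thesis using \<gamma>_pos by (simp add: powr_realpow)
qed

text \<open>With \<open>n = m * q + k\<close>, contraction of \<open>B^k f\<close> compares
  \<open>s ^ q * B^n f(x)\<close> with \<open>\<gamma> ^ k * Er f / Er u\<close> times
  \<open>u(x)\<close>. The relative error decays geometrically in \<open>q\<close>, uniformly over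
  the finitely many \<open>k\<close>.\<close>

theorem Bop_power_asymptotics:
  assumes [measurable]: "f \<in> borel_measurable borel" and c: "0 \<le> c" and f: "\<And>x. f x \<le> ennreal c"
    and pos: "0 < E f"
  shows "(\<lambda>n. enn2real ((Bop ^^ n) f x) / ((1 / s) powr (real n / real m) * (enn2real (u x) * Er f / Er u)))
    \<longlonglongrightarrow> 1"
proof -
  define c' where "c' = c / (\<delta> * s)"
  have c': "0 \<le> c'" using c \<delta>s_pos by (simp add: c'_def)
  have Erf: "0 < Er f"
    using pos E_finite[OF f] by (simp add: enn2real_positive_iff)
  define ux where "ux = enn2real (u x)"
  have ux: "u x = ennreal ux"
    unfolding ux_def by (rule ennreal_enn2real[symmetric]) (rule le_less_trans[OF u_le], simp)
  have ux0: "0 < ux"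
    using u_ge[of x] \<delta>s_pos unfolding ux by (simp add: ux_def) 
  define Q where "Q n = enn2real ((Bop ^^ n) f x) / ((1 / s) powr (real n / real m) * (ux * Er f / Er u))" for n
  \<comment> \<open>Replacing \<open>\<gamma> ^ k\<close> by the smaller \<open>\<gamma> ^ m\<close>
    makes the error constant independent of the remainder \<open>k\<close>.\<close>
  let ?d = "c' / (\<gamma> ^ m * Er f / Er u)"
  have bound: "\<bar>Q n - 1\<bar> \<le> (1 - \<epsilon>) ^ (n div m) * ?d" for n
  proof -
    define q k where "q = n div m" and "k = n mod m"
    have n: "n = m * q + k" by (simp add: q_def k_def)
    let ?g = "(Bop ^^ k) f"
    have g: "?g x \<le> ennreal c" for x by (rule Bop_le_const[OF _ f]) simp
    have gu: "?g x \<le> ennreal c' * u x" for x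
      using order_trans[OF g const_le_u[OF c]] by (simp add: c'_def)
    obtain l r where lr: "0 \<le> l" "l \<le> r" "r - l = (1 - \<epsilon>) ^ q * c'"
      and lo: "\<And>x. ennreal l * u x \<le> ennreal (s ^ q) * (Kop ^^ q) ?g x"
      and up: "\<And>x. ennreal (s ^ q) * (Kop ^^ q) ?g x \<le> ennreal r * u x"
      using contraction[OF _ c' gu, of q] by auto
    have r0: "0 \<le> r" using lr by simp
    have "ennreal l * E u \<le> E ?g" "E ?g \<le> ennreal r * E u"
      using E_mono[of "\<lambda>x. ennreal l * u x", OF lo] E_mono[of _ "\<lambda>x. ennreal r * u x", OF up] by (simp_all add: E_Kop_power E_cmult)
    then have "l * Er u \<le> Er ?g" "Er ?g \<le> r * Er u"
      using lr(1) r0 E_finite[OF g] E_finite[OF u_le]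
      by (auto intro: mult_enn2real_le enn2real_le_mult)
    then have 1: "l \<le> \<gamma> ^ k * Er f / Er u" "\<gamma> ^ k * Er f / Er u \<le> r"
      using Er_u_ge by (simp_all add: Er_Bop_power[OF _ c f] field_simps)
    define y where "y = enn2real ((Bop ^^ n) f x)"
    have "(Bop ^^ n) f x \<le> ennreal c" by (rule Bop_le_const[OF _ f]) simp
    then have y: "(Bop ^^ n) f x = ennreal y"
      unfolding y_def by (intro ennreal_enn2real[symmetric]) (rule le_less_trans, auto)
    have y0: "0 \<le> y" by (simp add: y_def)
    have K: "(Kop ^^ q) ?g x = ennreal y"
      unfolding y[symmetric] n by (simp add: Kop_power_eq funpow_add)
    have 2: "l * ux \<le> s ^ q * y" "s ^ q * y \<le> r * ux"
      using lo[of x] up[of x] lr(1) r0 ux0 y0 s_pos unfolding K ux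
      by (simp_all add: ennreal_mult[symmetric])
    let ?D = "\<gamma> ^ k * Er f / Er u"
    have D: "0 < ?D" using \<gamma>_pos Erf Er_u_ge by simp
    have diff: "\<bar>s ^ q * y - ?D * ux\<bar> \<le> (1 - \<epsilon>) ^ q * c' * ux"
      using 2 mult_right_mono[OF 1(1), of ux] mult_right_mono[OF 1(2), of ux] ux0
      by (simp add: lr(3)[symmetric] left_diff_distrib)
    \<comment> \<open>This matches the normalization of the quotient, \<open>\<gamma> ^ n\<close>,
      with the factor \<open>s ^ q\<close> from the contraction.\<close>
    have "\<gamma> ^ k = s ^ q * \<gamma> ^ n"
      using s_pos by (simp add: n power_add power_mult \<gamma>_power_m power_divide)
    then have Q: "Q n = s ^ q * y / (?D * ux)"
      using s_pos unfolding Q_def powr_eq y_def[symmetric] by simp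
    have nz: "?D * ux \<noteq> 0" using mult_pos_pos[OF D ux0] by (rule less_imp_neq[symmetric])
    have "Q n - 1 = (s ^ q * y - ?D * ux) / (?D * ux)"
      unfolding diff_divide_distrib divide_self[OF nz] Q ..
    then have "\<bar>Q n - 1\<bar> = \<bar>s ^ q * y - ?D * ux\<bar> / (?D * ux)"
      using mult_pos_pos[OF D ux0] by (simp only: abs_divide abs_of_pos)
    also have "\<dots> \<le> (1 - \<epsilon>) ^ q * c' * ux / (?D * ux)"
      using diff less_imp_le[OF mult_pos_pos[OF D ux0]] by (rule divide_right_mono)
    also have "\<dots> = (1 - \<epsilon>) ^ q * (c' / ?D)"
      using ux0 by simp
    also have "\<dots> \<le> (1 - \<epsilon>) ^ q * ?d"
    proof -
      have "k \<le> m" using m_ge_1 by (auto simp: k_def intro: less_imp_le)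
      then have "\<gamma> ^ m \<le> \<gamma> ^ k" using \<gamma>_pos \<gamma>_le_1 by (intro power_decreasing) auto
      then have "\<gamma> ^ m * Er f / Er u \<le> ?D"
        using Erf Er_u_ge by (intro divide_right_mono mult_right_mono) auto
      moreover have "0 < \<gamma> ^ m * Er f / Er u" using \<gamma>_pos Erf Er_u_ge by simp
      ultimately show ?thesis
        using c' \<epsilon> by (intro mult_left_mono divide_left_mono mult_pos_pos[OF D]) auto
    qed
    finally show ?thesis unfolding q_def .
  qed
  have div_lim: "filterlim (\<lambda>n. n div m) sequentially sequentially"
    unfolding filterlim_at_top
  proof
    fix N
    show "\<forall>\<^sub>F n in sequentially. N \<le> n div m"
      using eventually_ge_at_top[of "N * m"] by eventually_elim (use m_ge_1 in \<open>simp add: less_eq_div_iff_mult_less_eq\<close>)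
  qed
  have "(\<lambda>q. (1 - \<epsilon>) ^ q * ?d) \<longlonglongrightarrow> 0 * ?d"
    using \<epsilon> by (intro tendsto_mult tendsto_const LIMSEQ_realpow_zero) auto
  from filterlim_compose[OF this div_lim] have "(\<lambda>n. (1 - \<epsilon>) ^ (n div m) * ?d) \<longlonglongrightarrow> 0"
    by simp
  then have "(\<lambda>n. Q n - 1) \<longlonglongrightarrow> 0"
    by (rule Lim_null_comparison[rotated]) (use bound in auto)
  then show ?thesis
    unfolding Q_def ux_def by (rule LIM_zero_cancel)
qed

end

section \<open>The split chain in terms of the remainder\<close>

text \<open>If \<open>Q\<close> never holds, the infimum is infinite and both sides are true, so
  infinite times need no separate treatment.\<close>

lemma enat_less_Inf_iff: "enat n < Inf {enat k |k. Q k} \<longleftrightarrow> (\<forall>k\<le>n. \<not> Q k)"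
proof -
  have "enat n < Inf {enat k |k. Q k} \<longleftrightarrow> (\<forall>k. Q k \<longrightarrow> Suc n \<le> k)"
    by (auto simp flip: Suc_ile_eq simp: le_Inf_iff)
  also have "\<dots> \<longleftrightarrow> (\<forall>k\<le>n. \<not> Q k)"
    by (meson not_less_eq_eq)
  finally show ?thesis .
qed

lemma Inf_eq_enat_iff: "Inf {enat k |k. Q k} = enat n \<longleftrightarrow> Q n \<and> (\<forall>k<n. \<not> Q k)"
proof -
  have "enat n \<le> Inf {enat k |k. Q k} \<longleftrightarrow> (\<forall>k<n. \<not> Q k)"
    by (auto simp: le_Inf_iff) (metis not_le)
  moreover have "Inf {enat k |k. Q k} = enat n
      \<longleftrightarrow> enat n \<le> Inf {enat k |k. Q k} \<and> \<not> enat n < Inf {enat k |k. Q k}"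
    by auto
  ultimately show ?thesis
    unfolding enat_less_Inf_iff by (auto simp: le_less)
qed

text \<open>The value zero at the cemetery builds the survival indicator into expectations.\<close>

definition killed_extension :: "('a \<Rightarrow> ennreal) \<Rightarrow> 'a option \<Rightarrow> ennreal" where
  "killed_extension f z = (case z of None \<Rightarrow> 0 | Some y \<Rightarrow> f y)"

lemma killed_extension_simps [simp]: "killed_extension f None = 0" "killed_extension f (Some y) = f y"
  by (simp_all add: killed_extension_def)

lemma measurable_killed_extension [measurable]: "f \<in> borel_measurable borel \<Longrightarrow> killed_extension f \<in> borel_measurable killed_space"
  by (rule measurable_killed_space) auto

lemma image_Some_sets [measurable]: "C \<in> sets borel \<Longrightarrow> Some ` C \<in> sets killed_space"
  by (simp add: sets_killed_space inj_vimage_image_eq)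

locale doeblin_split =
  doeblin_kernel B \<nu> m b v c1 c2 + split_chain B m "delta \<nu> b v c1" "psi \<nu> b v" P F X D
  for B :: "'a::topological_space \<Rightarrow> 'a measure" and \<nu> m b v c1 c2
    and P :: "'a \<Rightarrow> 'w measure" and F X D
begin

section \<open>Filtration and absorption\<close>

lemma space_F: "space (F n) = space (P x)"
  using subalg[of x n] by (simp add: subalgebra_def)

lemma sets_F: "H \<in> sets (F n) \<Longrightarrow> H \<in> sets (P x)"
  using subalg[of x n] by (auto simp: subalgebra_def)

lemma sets_F_mono: "i \<le> n \<Longrightarrow> sets (F i) \<subseteq> sets (F n)"
  using lift_Suc_mono_le[of "\<lambda>n. sets (F n)"] filtr by blast

lemma measurable_X [measurable]: "X n \<in> P x \<rightarrow>\<^sub>M killed_space"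
  by (rule measurable_from_subalg[OF subalg X_adapted])

lemma measurable_D [measurable]: "D k \<in> P x \<rightarrow>\<^sub>M count_space UNIV"
  by (rule measurable_from_subalg[OF subalg D_adapted])

text \<open>Absorption is a property of the kernel: from \<open>None\<close> it gives no mass to
  \<open>range Some\<close>. The Markov property turns this into an almost sure statement for all
  times at once.\<close>

lemma AE_absorbed: "AE \<omega> in P x. \<forall>n k. X (k + n) \<omega> \<noteq> None \<longrightarrow> X n \<omega> \<noteq> None"
proof -
  have step: "AE \<omega> in P x. X n \<omega> = None \<longrightarrow> X (Suc n) \<omega> = None" for n
  proof -
    have S: "range Some \<in> sets (killed_space :: 'a option measure)" "{None} \<in> sets (killed_space :: 'a option measure)"
      using image_Some_sets[of UNIV] by (auto simp: sets_killed_space vimage_def)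
    let ?H = "X n -` {None} \<inter> space (F n)"
    have H: "?H \<in> sets (F n)"
      by (rule measurable_sets[OF X_adapted S(2)])
    have "emeasure (P x) {\<omega> \<in> ?H. X (Suc n) \<omega> \<in> range Some}
        = (\<integral>\<^sup>+\<omega>\<in>?H. killed_kernel B (X n \<omega>) (range Some) \<partial>P x)"
      by (rule markov[OF H S(1)])
    also have "\<dots> = (\<integral>\<^sup>+\<omega>. 0 \<partial>P x)"
      by (intro nn_integral_cong) (auto simp: killed_kernel_def split: split_indicator)
    finally have 0: "emeasure (P x) {\<omega> \<in> ?H. X (Suc n) \<omega> \<in> range Some} = 0" by simp
    moreover have "{\<omega> \<in> ?H. X (Suc n) \<omega> \<in> range Some} \<in> sets (P x)"
      using sets.Int[OF sets_F[OF H] measurable_sets[OF measurable_X S(1), of "Suc n" x]]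
      by (simp add: Int_def vimage_def space_F[of _ x] conj_ac)
    ultimately show ?thesis
      by (rule AE_I[rotated 1]) (auto simp: space_F[of _ x])
  qed
  have "AE \<omega> in P x. \<forall>n. X n \<omega> = None \<longrightarrow> X (Suc n) \<omega> = None"
    using step by (simp add: AE_all_countable)
  then show ?thesis
  proof eventually_elim
    case (elim \<omega>)
    show ?case
    proof (intro allI impI)
      fix n k assume "X (k + n) \<omega> \<noteq> None"
      with elim show "X n \<omega> \<noteq> None" by (induction k) (simp, metis add_Suc)
    qed
  qed
qed

text \<open>On an absorbed path, being alive at time \<open>n\<close> rules out any earlier visit to
  \<open>None\<close>, so survival can be tested at one time.\<close>

lemma AE_absorption_time:
  "AE \<omega> in P x. \<forall>n. enat n < absorption_time X \<omega> \<longleftrightarrow> X n \<omega> \<noteq> None"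
  using AE_absorbed
proof eventually_elim
  case (elim \<omega>)
  then show ?case
    unfolding absorption_time_def enat_less_Inf_iff by (metis le_add_diff_inverse2 order_refl)
qed

section \<open>One step of the randomized skeleton\<close>

lemma split_kernel_True:
  "split_kernel (kernel_power B m) \<delta> \<psi> z True (range Some) = killed_extension (\<lambda>_. ennreal \<delta>) z"
  using psi.emeasure_space_1 by (cases z) (auto simp: split_kernel_def inj_vimage_image_eq)

lemma split_kernel_False:
  assumes [measurable]: "C \<in> sets borel"
  shows "split_kernel (kernel_power B m) \<delta> \<psi> z False (Some ` C) = killed_extension (Rop (indicator C)) z"
proof (cases z)
  case (Some x)
  let ?K = "kernel_power B m x" and ?S = "scale_measure (ennreal \<delta>) \<psi>"
  have K: "emeasure ?K A = ennreal \<delta> * emeasure \<psi> A + Rop (indicator A) x" if "A \<in> sets borel" for A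
    using that Kop_split[of "indicator A" x] Kop_eq_Bop_power[of "indicator A"]
    by (simp add: emeasure_kernel_power)
  have "emeasure (diff_measure ?K ?S) C = emeasure ?K C - emeasure ?S C"
  proof (rule emeasure_diff_measure)
    show "finite_measure ?K"
      using B_le[OF kernel_power_measurable[OF kernel], of m x UNIV]
      by (intro finite_measureI) (auto simp: sets_power top_unique)
    show "finite_measure ?S"
      using psi.emeasure_space_1 by (intro finite_measureI) (simp add: space_scale_measure)
  qed (use K in \<open>auto simp: sets_power\<close>)
  also have "\<dots> = Rop (indicator C) x"
    using psi.emeasure_le_1[of C] by (simp add: K ennreal_mult_eq_top_iff top_unique)
  finally show ?thesis
    using Some by (auto simp: split_kernel_def inj_vimage_image_eq)
qed (auto simp: split_kernel_def)

text \<open>Extends \<open>skeleton\<close> from sets to functions: indicators come from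
  \<open>split_kernel_False\<close>, the rest from linearity and monotone convergence.\<close>

lemma skeleton_Rop:
  assumes f: "f \<in> borel_measurable borel" and H: "H \<in> sets (F (k * m))"
  shows "(\<integral>\<^sup>+\<omega>\<in>H. (of_bool (\<not> D (Suc k) \<omega>) * killed_extension f (X (Suc k * m) \<omega>)) \<partial>P x)
    = (\<integral>\<^sup>+\<omega>\<in>H. killed_extension (Rop f) (X (k * m) \<omega>) \<partial>P x)"
  using f
proof (induction rule: borel_measurable_induct)
  case (cong f g)
  then have "f = g" by auto
  with cong show ?case by simp
next
  note [measurable] = sets_F[OF H, of x]
  case (set C)
  let ?G = "{\<omega> \<in> H. D (Suc k) \<omega> = False \<and> X (Suc k * m) \<omega> \<in> Some ` C}"
  have G: "?G \<in> sets (P x)"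
  proof -
    have "?G = H \<inter> (D (Suc k) -` {False} \<inter> space (P x)) \<inter> (X (Suc k * m) -` (Some ` C) \<inter> space (P x))"
      using sets.sets_into_space[OF sets_F[OF H, of x]] by auto
    also have "\<dots> \<in> sets (P x)"
      using set by (intro sets.Int measurable_sets[OF measurable_D] measurable_sets[OF measurable_X]) auto
    finally show ?thesis .
  qed
  have "(\<integral>\<^sup>+\<omega>\<in>H. (of_bool (\<not> D (Suc k) \<omega>) * killed_extension (indicator C) (X (Suc k * m) \<omega>)) \<partial>P x)
      = (\<integral>\<^sup>+\<omega>. indicator ?G \<omega> \<partial>P x)"
    by (intro nn_integral_cong) (auto simp: killed_extension_def simp del: mult_Suc split: split_indicator option.split)
  also have "\<dots> = emeasure (P x) ?G"
    by (rule nn_integral_indicator[OF G])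
  also have "\<dots> = (\<integral>\<^sup>+\<omega>\<in>H. killed_extension (Rop (indicator C)) (X (k * m) \<omega>) \<partial>P x)"
    using set by (subst skeleton[OF H]) (auto simp: split_kernel_False)
  finally show ?case .
next
  note [measurable] = sets_F[OF H, of x]
  case (mult u c)
  note [measurable] = mult(2)
  have e: "killed_extension (\<lambda>y. c * h y) z = c * killed_extension h z" for h :: "'a \<Rightarrow> ennreal" and z
    by (cases z) auto
  show ?case
    using mult.IH by (simp add: Rop_cmult e nn_integral_cmult mult.assoc mult.left_commute[of _ c] del: mult_Suc)
next
  note [measurable] = sets_F[OF H, of x]
  case (add u w)
  note [measurable] = \<open>u \<in> borel_measurable borel\<close> \<open>w \<in> borel_measurable borel\<close>
  have e: "killed_extension (\<lambda>y. h y + g y) z = killed_extension h z + killed_extension g z" for h g :: "'a \<Rightarrow> ennreal" and z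
    by (cases z) auto
  show ?case
    using add.IH by (simp add: Rop_add e nn_integral_add distrib_left distrib_right del: mult_Suc)
next
  note [measurable] = sets_F[OF H, of x]
  case (seq U)
  have [measurable]: "U i \<in> borel_measurable borel" for i by (rule seq(1))
  have inc: "incseq (\<lambda>i. U i y)" for y
    using seq(3) by (auto simp: incseq_def le_fun_def)
  have e: "killed_extension (SUP i. V i) z = (SUP i. killed_extension (V i) z)" for V :: "nat \<Rightarrow> 'a \<Rightarrow> ennreal" and z
    by (cases z) (auto simp: image_comp)
  have R: "Rop (SUP i. U i) = (SUP i. Rop (U i))"
  proof
    fix y
    have "Rop (SUP i. U i) y = (\<integral>\<^sup>+z. (SUP i. ennreal (b y z - c1 * b v z) * U i z) \<partial>\<nu>)"
      unfolding Rop_def by (simp add: image_comp SUP_mult_left_ennreal)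
    also have "\<dots> = (SUP i. Rop (U i) y)"
      unfolding Rop_def using inc
      by (intro nn_integral_monotone_convergence_SUP) (auto simp: incseq_def le_fun_def intro!: mult_left_mono)
    finally show "Rop (SUP i. U i) y = (SUP i. Rop (U i)) y" by (simp add: image_comp)
  qed
  have mono: "killed_extension (U i) z \<le> killed_extension (U j) z" "killed_extension (Rop (U i)) z \<le> killed_extension (Rop (U j)) z" if "i \<le> j" for i j z
    using incseqD[OF inc that] by (cases z; auto intro: Rop_mono)+
  have "(\<integral>\<^sup>+\<omega>\<in>H. (of_bool (\<not> D (Suc k) \<omega>) * killed_extension (SUP i. U i) (X (Suc k * m) \<omega>)) \<partial>P x)
      = (\<integral>\<^sup>+\<omega>. (SUP i. of_bool (\<not> D (Suc k) \<omega>) * killed_extension (U i) (X (Suc k * m) \<omega>) * indicator H \<omega>) \<partial>P x)"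
    by (simp add: e SUP_mult_left_ennreal SUP_mult_right_ennreal del: mult_Suc)
  also have "\<dots> = (SUP i. \<integral>\<^sup>+\<omega>\<in>H. (of_bool (\<not> D (Suc k) \<omega>) * killed_extension (U i) (X (Suc k * m) \<omega>)) \<partial>P x)"
    by (intro nn_integral_monotone_convergence_SUP)
       (auto simp: incseq_def le_fun_def simp del: mult_Suc intro!: mult_right_mono mult_left_mono mono)
  also have "\<dots> = (SUP i. \<integral>\<^sup>+\<omega>\<in>H. killed_extension (Rop (U i)) (X (k * m) \<omega>) \<partial>P x)"
    by (simp only: seq.IH)
  also have "\<dots> = (\<integral>\<^sup>+\<omega>. (SUP i. killed_extension (Rop (U i)) (X (k * m) \<omega>) * indicator H \<omega>) \<partial>P x)"
    by (intro nn_integral_monotone_convergence_SUP[symmetric])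
       (auto simp: incseq_def le_fun_def intro!: mult_right_mono mono)
  also have "\<dots> = (\<integral>\<^sup>+\<omega>\<in>H. killed_extension (Rop (SUP i. U i)) (X (k * m) \<omega>) \<partial>P x)"
    by (simp add: e R SUP_mult_right_ennreal)
  finally show ?case .
qed

section \<open>Regeneration functionals as operator series\<close>

text \<open>The event \<open>\<tau> > j\<close>. The index shift excludes \<open>D 0\<close>, and
  \<open>space (F 0)\<close> keeps the set independent of the starting point.\<close>

definition no_draw :: "nat \<Rightarrow> 'w set" where
  "no_draw j = {\<omega> \<in> space (F 0). \<forall>i<j. \<not> D (Suc i) \<omega>}"

lemma no_draw_iff: "\<omega> \<in> no_draw j \<longleftrightarrow> \<omega> \<in> space (P x) \<and> (\<forall>k\<le>j. \<not> (1 \<le> k \<and> D k \<omega>))"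
proof -
  have "(\<forall>k\<le>j. \<not> (1 \<le> k \<and> D k \<omega>)) \<longleftrightarrow> (\<forall>i<j. \<not> D (Suc i) \<omega>)"
  proof (intro iffI allI impI notI)
    fix k assume *: "\<forall>i<j. \<not> D (Suc i) \<omega>" "k \<le> j" "1 \<le> k \<and> D k \<omega>"
    then obtain i where "k = Suc i" by (cases k) auto
    with * show False by auto
  qed auto
  then show ?thesis by (simp add: no_draw_def space_F[of _ x])
qed

lemma no_draw_Suc: "no_draw (Suc j) = no_draw j \<inter> {\<omega> \<in> space (F 0). \<not> D (Suc j) \<omega>}"
  by (auto simp: no_draw_def less_Suc_eq)

lemma sets_no_draw: "no_draw j \<in> sets (F (j * m))"
proof (induction j)
  case 0
  have "no_draw 0 = space (F 0)" by (auto simp: no_draw_def)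
  then show ?case by simp
next
  case (Suc j)
  have s: "space (F 0) = space (F n)" for n
    using space_F by metis
  have "D (Suc j) -` {False} \<inter> space (F (Suc j * m)) \<in> sets (F (Suc j * m))"
    by (rule measurable_sets[OF D_adapted]) simp
  also have "D (Suc j) -` {False} \<inter> space (F (Suc j * m)) = {\<omega> \<in> space (F 0). \<not> D (Suc j) \<omega>}"
    using s by auto
  finally show ?case
    unfolding no_draw_Suc using Suc sets_F_mono[of "j * m" "Suc j * m"] by auto
qed

lemma measurable_no_draw [measurable]: "no_draw j \<in> sets (P x)"
  by (rule sets_F[OF sets_no_draw])

text \<open>Peeling off the last skeleton step replaces \<open>f\<close> by \<open>Rop f\<close>;
  \<open>no_draw j\<close> lies in the past at time \<open>j * m\<close>, as
  \<open>skeleton_Rop\<close> requires.\<close>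

lemma nn_integral_no_draw:
  assumes "f \<in> borel_measurable borel"
  shows "(\<integral>\<^sup>+\<omega>\<in>no_draw j. killed_extension f (X (j * m) \<omega>) \<partial>P x) = (Rop ^^ j) f x"
  using assms
proof (induction j arbitrary: f)
  case 0
  interpret prob_space "P x" by (rule prob)
  have "(\<integral>\<^sup>+\<omega>\<in>no_draw 0. killed_extension f (X (0 * m) \<omega>) \<partial>P x) = (\<integral>\<^sup>+\<omega>. f x \<partial>P x)"
    using initial[of x] AE_space
    by (intro nn_integral_cong_AE, eventually_elim) (auto simp: no_draw_def space_F[of _ x])
  then show ?case by (simp add: emeasure_space_1)
next
  case (Suc j)
  have "(\<integral>\<^sup>+\<omega>\<in>no_draw (Suc j). killed_extension f (X (Suc j * m) \<omega>) \<partial>P x)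
      = (\<integral>\<^sup>+\<omega>\<in>no_draw j. (of_bool (\<not> D (Suc j) \<omega>) * killed_extension f (X (Suc j * m) \<omega>)) \<partial>P x)"
    by (intro nn_integral_cong)
       (auto simp: no_draw_Suc space_F[of _ x] simp del: mult_Suc split: split_indicator)
  also have "\<dots> = (\<integral>\<^sup>+\<omega>\<in>no_draw j. killed_extension (Rop f) (X (j * m) \<omega>) \<partial>P x)"
    by (rule skeleton_Rop[OF Suc.prems sets_no_draw])
  also have "\<dots> = (Rop ^^ Suc j) f x"
    by (subst Suc.IH) (use Suc.prems in \<open>auto simp: funpow_Suc_right simp del: funpow.simps\<close>)
  finally show ?case .
qed

text \<open>Almost surely, \<open>\<tau> = i + 1\<close> with survival means no draw up to
  \<open>i\<close>, a draw at \<open>i + 1\<close>, and a state in \<open>S\<close>. Given the past,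
  that draw has probability \<open>\<delta>\<close> on survival.\<close>

lemma regen_expectation_eq:
  "regen_expectation m P X D f x = (\<Sum>i. ennreal (f (Suc i)) * (ennreal \<delta> * (Rop ^^ i) (\<lambda>_. 1) x))"
proof -
  let ?G = "\<lambda>i. {\<omega> \<in> no_draw i. D (Suc i) \<omega> = True \<and> X (Suc i * m) \<omega> \<in> range Some}"
  have G: "?G i \<in> sets (P x)" for i
  proof -
    have "?G i = no_draw i \<inter> (D (Suc i) -` {True} \<inter> space (P x)) \<inter> (X (Suc i * m) -` range Some \<inter> space (P x))"
      using sets.sets_into_space[OF measurable_no_draw, of i x] by auto
    also have "\<dots> \<in> sets (P x)"
      by (intro sets.Int measurable_sets[OF measurable_D] measurable_sets[OF measurable_X] image_Some_sets) auto
    finally show ?thesis .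
  qed
  have e: "emeasure (P x) (?G i) = ennreal \<delta> * (Rop ^^ i) (\<lambda>_. 1) x" for i
  proof -
    have "emeasure (P x) (?G i) = (Rop ^^ i) (\<lambda>_. ennreal \<delta>) x"
      by (subst skeleton[OF sets_no_draw image_Some_sets])
         (simp_all add: split_kernel_True nn_integral_no_draw)
    then show ?thesis
      using Rop_power_cmult[of "\<lambda>_. 1" i "ennreal \<delta>"] by simp
  qed
  have "regen_expectation m P X D f x = (\<integral>\<^sup>+\<omega>. (\<Sum>i. ennreal (f (Suc i)) * indicator (?G i) \<omega>) \<partial>P x)"
    unfolding regen_expectation_def
    using AE_absorption_time[of x] AE_space[of "P x"]
  proof (intro nn_integral_cong_AE, eventually_elim)
    case (elim \<omega>)
    have "of_bool (regeneration_time D \<omega> = enat (Suc i) \<and> enat (Suc i * m) < absorption_time X \<omega>)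
        = (indicator (?G i) \<omega> :: ennreal)" for i
      using elim unfolding regeneration_time_def Inf_eq_enat_iff
      by (auto simp: no_draw_iff[of _ _ x] less_Suc_eq_le indicator_def simp del: mult_Suc)
    then show ?case by (simp add: Let_def del: mult_Suc)
  qed
  also have "\<dots> = (\<Sum>i. \<integral>\<^sup>+\<omega>. ennreal (f (Suc i)) * indicator (?G i) \<omega> \<partial>P x)"
    by (intro nn_integral_suminf borel_measurable_times_ennreal borel_measurable_const borel_measurable_indicator G)
  also have "\<dots> = (\<Sum>i. ennreal (f (Suc i)) * (ennreal \<delta> * (Rop ^^ i) (\<lambda>_. 1) x))"
    by (simp only: nn_integral_cmult_indicator[OF G] e)
  finally show ?thesis .
qed

lemma nn_integral_regen_expectation:
  "(\<integral>\<^sup>+x. regen_expectation m P X D f x \<partial>\<psi>) = (\<Sum>i. ennreal (f (Suc i)) * (ennreal \<delta> * tail i))"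
  unfolding regen_expectation_eq tail_def
  by (subst nn_integral_suminf, measurable) (intro suminf_cong, simp add: nn_integral_cmult)

text \<open>Almost surely, the indicators are those of \<open>no_draw j\<close> and of
  \<open>C\<close> extended by zero, so \<open>nn_integral_no_draw\<close> applies termwise.\<close>

lemma nn_integral_occupation:
  assumes C: "C \<in> sets borel"
  shows "(\<integral>\<^sup>+\<omega>. (\<Sum>j. of_bool (enat j < regeneration_time D \<omega>) * ennreal (w j)
        * of_bool (X (j * m) \<omega> \<in> Some ` C \<and> enat (j * m) < absorption_time X \<omega>)) \<partial>P x)
    = (\<Sum>j. ennreal (w j) * (Rop ^^ j) (indicator C) x)" (is "?L = _")
proof -
  have [measurable]: "indicator C \<in> borel_measurable borel" using C by simp
  have "?L = (\<integral>\<^sup>+\<omega>. (\<Sum>j. ennreal (w j) * (killed_extension (indicator C) (X (j * m) \<omega>) * indicator (no_draw j) \<omega>)) \<partial>P x)"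
    using AE_absorption_time[of x] AE_space[of "P x"]
  proof (intro nn_integral_cong_AE, eventually_elim)
    case (elim \<omega>)
    have 1: "of_bool (enat j < regeneration_time D \<omega>) = (indicator (no_draw j) \<omega> :: ennreal)" for j
      using elim unfolding regeneration_time_def enat_less_Inf_iff
      by (auto simp: no_draw_iff[of _ _ x] indicator_def)
    have 2: "of_bool (X (j * m) \<omega> \<in> Some ` C \<and> enat (j * m) < absorption_time X \<omega>)
        = killed_extension (indicator C) (X (j * m) \<omega>)" for j
      using elim by (auto simp: killed_extension_def indicator_def split: option.split)
    show ?case unfolding 1 2 by (simp add: mult_ac)
  qed
  also have "\<dots> = (\<Sum>j. ennreal (w j) * (Rop ^^ j) (indicator C) x)"
    by (simp add: nn_integral_suminf nn_integral_cmult nn_integral_no_draw)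
  finally show ?thesis .
qed

end

section \<open>Identification of the probabilistic objects and conclusion\<close>

theorem theorem7:
  fixes B :: "'a::metric_space \<Rightarrow> 'a measure"
    and \<nu> :: "'a measure" and m :: nat and b :: "'a \<Rightarrow> 'a \<Rightarrow> real"
    and v :: 'a and c1 c2 :: real
    and P :: "'a \<Rightarrow> 'w measure" and F :: "nat \<Rightarrow> 'w measure"
    and X :: "nat \<Rightarrow> 'w \<Rightarrow> 'a option" and D :: "nat \<Rightarrow> 'w \<Rightarrow> bool"
  assumes kernel: "B \<in> borel \<rightarrow>\<^sub>M subprob_algebra borel"
    and nu: "prob_space \<nu>" "sets \<nu> = sets borel"
    and m: "1 \<le> m"
    and b_meas: "(\<lambda>(x, y). b x y) \<in> borel_measurable (borel \<Otimes>\<^sub>M borel)"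
    and b_pos: "\<And>x y. 0 < b x y"
    and b_density: "\<And>x. kernel_power B m x = density \<nu> (\<lambda>y. ennreal (b x y))"
    and c1: "0 < c1" "ereal c1 = (INF x. INF y. ereal (b x y / b v y))"
    and c2: "ereal c2 = (SUP x. SUP y. ereal (b x y / b v y))"
    and chain: "split_chain B m (delta \<nu> b v c1) (psi \<nu> b v) P F X D"
  shows "(\<exists>\<theta>. regen_parameter m (psi \<nu> b v) P X D \<theta>) \<and>
    (\<forall>\<theta>. regen_parameter m (psi \<nu> b v) P X D \<theta> \<longrightarrow>
      (let lambda_star = exp (- \<theta>);
           u = u_star m P X D \<theta>;
           \<eta> = eta_star m (psi \<nu> b v) P X D \<theta>
       in \<forall>x C. C \<in> sets borel \<longrightarrow> 0 < emeasure \<eta> C \<longrightarrow>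
            (\<lambda>n. measure (kernel_power B n x) C
                 / (lambda_star powr (real n / real m)
                    * (enn2real (u x) * measure \<eta> C / enn2real (\<integral>\<^sup>+w. u w \<partial>\<eta>))))
              \<longlonglongrightarrow> 1))"
proof -
  have lower: "c1 * b v y \<le> b x y" for x y
  proof -
    have "ereal c1 \<le> ereal (b x y / b v y)"
      unfolding c1(2) by (intro INF_lower2[of x] INF_lower) auto
    then show ?thesis using b_pos[of v y] by (simp add: field_simps)
  qed
  have upper: "b x y \<le> c2 * b v y" for x y
  proof -
    have "ereal (b x y / b v y) \<le> ereal c2"
      unfolding c2 by (intro SUP_upper2[of x] SUP_upper) auto
    then show ?thesis using b_pos[of v y] by (simp add: field_simps)
  qed
  interpret doeblin_kernel B \<nu> m b v c1 c2
    by (rule doeblin_kernel.intro) (fact kernel nu m b_meas b_pos b_density c1(1) lower upper)+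
  interpret split_chain B m \<delta> \<psi> P F X D by (rule chain)
  interpret doeblin_split B \<nu> m b v c1 c2 P F X D ..
  have regen: "(\<integral>\<^sup>+x. regen_expectation m P X D (\<lambda>k. exp (\<theta> * real k)) x \<partial>\<psi>)
      = (\<Sum>i. ennreal (exp \<theta> ^ Suc i) * (ennreal \<delta> * tail i))" for \<theta>
    by (simp only: nn_integral_regen_expectation exp_of_nat2_mult)
  have "\<exists>\<theta>. regen_parameter m \<psi> P X D \<theta>"
  proof -
    obtain s :: real where s: "1 \<le> s" "(\<Sum>k. ennreal (s ^ Suc k) * (ennreal \<delta> * tail k)) = 1"
      "(\<Sum>k. ennreal (real (Suc k) * s ^ Suc k) * (ennreal \<delta> * tail k)) < \<infinity>"
      by (rule regeneration_root)
    have e: "exp (ln s) = s" using s(1) by simp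
    \<comment> \<open>The choice \<open>\<theta> = ln s\<close> is nonnegative because
      \<open>1 \<le> s\<close>.\<close>
    have "regen_parameter m \<psi> P X D (ln s)"
      unfolding regen_parameter_def regen using s
      by (simp only: nn_integral_regen_expectation exp_of_nat2_mult e ln_ge_zero simp_thms)
    then show ?thesis ..
  qed
  moreover have "(\<lambda>n. measure (kernel_power B n x) C
      / (exp (- \<theta>) powr (real n / real m)
        * (enn2real (u_star m P X D \<theta> x) * measure (eta_star m \<psi> P X D \<theta>) C
          / enn2real (\<integral>\<^sup>+w. u_star m P X D \<theta> w \<partial>eta_star m \<psi> P X D \<theta>)))) \<longlonglongrightarrow> 1"
    if par: "regen_parameter m \<psi> P X D \<theta>" and C [measurable]: "C \<in> sets borel"
      and pos: "0 < emeasure (eta_star m \<psi> P X D \<theta>) C" for \<theta> x C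
  proof -
    interpret doeblin_eigen B \<nu> m b v c1 c2 "exp \<theta>"
      using par by unfold_locales (simp_all only: regen_parameter_def regen exp_gt_zero)
    have u: "u_star m P X D \<theta> = u"
      by (simp only: fun_eq_iff u_star_def u_def regen_expectation_eq exp_of_nat2_mult simp_thms)
    \<comment> \<open>\<open>measure_of\<close> yields the zero measure on a set function that is
      not a measure. Agreement with \<open>emeasure \<eta>\<close> on all Borel sets excludes that
      default.\<close>
    have "eta_star m \<psi> P X D \<theta> = measure_of UNIV (sets borel) (emeasure \<eta>)"
      unfolding eta_star_def
    proof (rule measure_of_eq)
      fix A :: "'a set" assume "A \<in> sigma_sets UNIV (sets borel)"
      then have A [measurable]: "A \<in> sets borel"
        using sets.sigma_sets_eq[of "borel :: 'a measure"] by simp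
      have "emeasure \<eta> A = (\<Sum>j. ennreal (exp \<theta> ^ j) * (\<integral>\<^sup>+x. (Rop ^^ j) (indicator A) x \<partial>\<psi>))"
        unfolding E_indicator[OF A, symmetric] by (rule E_eq) simp
      also have "\<dots> = (\<integral>\<^sup>+x. (\<Sum>j. ennreal (exp (\<theta> * real j)) * (Rop ^^ j) (indicator A) x) \<partial>\<psi>)"
        unfolding exp_of_nat2_mult
        by (subst nn_integral_suminf, measurable) (intro suminf_cong, simp add: nn_integral_cmult)
      finally show "(\<integral>\<^sup>+x. (\<integral>\<^sup>+\<omega>. (\<Sum>j. of_bool (enat j < regeneration_time D \<omega>) * ennreal (exp (\<theta> * real j))
          * of_bool (X (j * m) \<omega> \<in> Some ` A \<and> enat (j * m) < absorption_time X \<omega>)) \<partial>P x) \<partial>\<psi>) = emeasure \<eta> A"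
        unfolding nn_integral_occupation[OF A] by (rule sym)
    qed simp
    also have "\<dots> = \<eta>"
      using measure_of_of_measure[of \<eta>] sets_eq_imp_space_eq[OF sets_eta] by simp
    finally have eta: "eta_star m \<psi> P X D \<theta> = \<eta>" .
    have "measure (kernel_power B n x) C = enn2real ((Bop ^^ n) (indicator C) x)" for n
      by (simp add: measure_def emeasure_kernel_power[OF C])
    moreover have "measure \<eta> C = Er (indicator C)"
      by (simp add: measure_def E_indicator[OF C])
    moreover have "exp (- \<theta>) = 1 / exp \<theta>"
      by (simp add: exp_minus inverse_eq_divide)
    moreover have "0 < E (indicator C)"
      using pos unfolding eta E_indicator[OF C] .
    ultimately show ?thesis
      unfolding u eta E_def[symmetric]
      using Bop_power_asymptotics[of "indicator C" 1 x] by (simp add: indicator_def)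
  qed
  ultimately show ?thesis
    unfolding Let_def by blast
qed

end
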